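(* Let $q\in L^1(0,\pi)$ be real-valued with Dirichlet-Dirichlet spectrum $\sigma_{DD}=\sigma_{0,0}=\{a_n\}_{n\in\mathbb{N}}$ and Neumann-Dirichlet spectrum $\sigma_{ND}=\sigma_{\pi/2,0}=\{b_n\}_{n\in\mathbb{N}}$, both contained in $(0,\infty)$, and let $\mu_{0,0}=\sum_{n\in\mathbb{N}}\gamma_n\delta_{a_n}$ be its spectral measure. Let $\{a_{k_n}\}_{n\in\mathbb{N}}\subset\sigma_{DD}$ and $\{b_{l_n}\}_{n\in\mathbb{N}}\subset\sigma_{ND}$ be subsequences (with $k_n$ and $l_n$ strictly increasing) such that $\prod_{n\in\mathbb{N}}(a_{k_n}/b_{l_n})$ is absolutely convergent. Then $\{a_n\}_{n\in\mathbb{N}}$, $\{b_n\}_{n\in\mathbb{N}}\setminus\{b_{l_n}\}_{n\in\mathbb{N}}$ and $\{\gamma_{k_n}\}_{n\in\mathbb{N}}$ determine the potential $q$. That is: if $\widetilde q\in L^1(0,\pi)$ is real-valued, with corresponding quantities $\widetilde a_n,\widetilde b_n,\widetilde\gamma_n$, and $\widetilde a_n=a_n$ for all $n\in\mathbb{N}$, $\widetilde b_j=b_j$ for all $j\in\mathbb{N}\setminus\{l_n:n\in\mathbb{N}\}$, and $\widetilde\gamma_{k_n}=\gamma_{k_n}$ for all $n\in\mathbb{N}$, then $\widetilde q=q$ almost everywhere on $(0,\pi)$.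
   Context: $\mathbb{N}=\{1,2,3,\dots\}$. For a real-valued potential $q\in L^1(0,\pi)$ consider the Schrödinger equation $-u''+qu=zu$ on $(0,\pi)$. The Dirichlet-Dirichlet spectrum $\sigma_{DD}=\{a_n\}_{n\in\mathbb{N}}$ is the set of eigenvalues for the boundary conditions $u(0)=0$, $u(\pi)=0$; the Neumann-Dirichlet spectrum $\sigma_{ND}=\{b_n\}_{n\in\mathbb{N}}$ is the set of eigenvalues for the boundary conditions $u'(0)=0$, $u(\pi)=0$. Both are discrete subsets of $\mathbb{R}$, bounded below, and are enumerated in increasing order. For each $n$ let $s_{a_n}$ be the solution of $-u''+qu=a_nu$ with $s_{a_n}(0)=0$, $s_{a_n}'(0)=1$; the point masses of the spectral measure $\mu_{0,0}=\sum_{n}\gamma_n\delta_{a_n}$ are $\gamma_n=\left(\int_0^\pi|s_{a_n}(t)|^2\,dt\right)^{-1}$. Equivalently, $\gamma_n=-\operatorname{Res}(m,a_n)$, where $m(z)=u_z'(0)/u_z(0)$ and $u_z$ is the solution of $-u''+qu=zu$ with $u_z(\pi)=0$, $u_z'(\pi)=-1$. Absolute convergence of $\prod_{n\in\mathbb{N}}(a_{k_n}/b_{l_n})$ means $\sum_{n\in\mathbb{N}}\left|a_{k_n}/b_{l_n}-1\right|<\infty$. *)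

theory Defs
  imports "HOL-Analysis.Analysis"
begin

(* "f is absolutely continuous on [0,pi] with derivative g almost everywhere", with absolutely
   continuous functions taken to be the indefinite Lebesgue integrals of L^1 functions.
   As usual, g is determined only up to a null set. *)
definition has_ac_derivative :: "(real \<Rightarrow> complex) \<Rightarrow> (real \<Rightarrow> complex) \<Rightarrow> bool" where
  "has_ac_derivative f g \<longleftrightarrow>
     g absolutely_integrable_on {0..pi} \<and>
     (\<forall>x\<in>{0..pi}. f x = f 0 + (LINT t:{0..x}|lebesgue. g t))"

(* u solves -u'' + q u = z u on (0,pi) in the Caratheodory sense: u is continuously differentiable
   on [0,pi] (one-sided derivatives at the end points), u' is absolutely continuous, and the
   equation holds almost everywhere. Both u and u' matter on [0,pi] only. *)
definition schroedinger_solution ::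
  "(real \<Rightarrow> real) \<Rightarrow> complex \<Rightarrow> (real \<Rightarrow> complex) \<Rightarrow> (real \<Rightarrow> complex) \<Rightarrow> bool" where
  "schroedinger_solution q z u u' \<longleftrightarrow>
     (\<forall>x\<in>{0..pi}. (u has_vector_derivative u' x) (at x within {0..pi})) \<and>
     (\<exists>u''. has_ac_derivative u' u'' \<and>
        (AE x in lebesgue. x \<in> {0<..<pi} \<longrightarrow>
           - u'' x + complex_of_real (q x) * u x = z * u x))"

definition sigma_DD :: "(real \<Rightarrow> real) \<Rightarrow> complex set" where
  "sigma_DD q = {z. \<exists>u u'. schroedinger_solution q z u u' \<and> (\<exists>x\<in>{0..pi}. u x \<noteq> 0) \<and>
                          u 0 = 0 \<and> u pi = 0}"

definition sigma_ND :: "(real \<Rightarrow> real) \<Rightarrow> complex set" where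
  "sigma_ND q = {z. \<exists>u u'. schroedinger_solution q z u u' \<and> (\<exists>x\<in>{0..pi}. u x \<noteq> 0) \<and>
                          u' 0 = 0 \<and> u pi = 0}"

(* The solution s_z with s_z(0) = 0 and s_z'(0) = 1. Its values are unique on [0,pi] but arbitrary
   outside, hence SOME rather than THE. *)
definition sine_solution :: "(real \<Rightarrow> real) \<Rightarrow> complex \<Rightarrow> real \<Rightarrow> complex" where
  "sine_solution q z = (SOME s. \<exists>s'. schroedinger_solution q z s s' \<and> s 0 = 0 \<and> s' 0 = 1)"

(* The mass at z of the spectral measure mu_{0,0}, for z in sigma_DD q. *)
definition spectral_mass :: "(real \<Rightarrow> real) \<Rightarrow> complex \<Rightarrow> real" where
  "spectral_mass q z = inverse (LINT t:{0..pi}|lebesgue. (cmod (sine_solution q z t))\<^sup>2)"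

end

theory Submission
  imports Defs "HOL-Complex_Analysis.Complex_Analysis"
begin

text \<open>Let \<open>sn\<close> and \<open>cs\<close> be the solutions with Cauchy data \<open>(0, 1)\<close> and \<open>(1, 0)\<close> at 0. As functions of
  the spectral parameter, \<open>sn pi\<close> and \<open>cs pi\<close> are entire with simple zeros \<open>a n\<close> and \<open>b n\<close>, and on
  circles \<open>norm z = (N + 1/4)\<^sup>2\<close> each changes by a relative \<open>O(1/N)\<close> only when the potential is
  changed. An entire function that is \<open>o(f)\<close> on such circles vanishes as soon as its zeros include a
  summable relative perturbation of the zeros of \<open>f\<close>. Hence the \<open>a n\<close> determine \<open>sn pi\<close>; since
  \<open>cs pi = \<gamma> * (sn pi)'\<close> at each \<open>a n\<close>, the difference of the two functions \<open>cs pi\<close> vanishes at the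
  \<open>a (k n)\<close> and at the common \<open>b j\<close>, so it is zero as well. Finally \<open>sn pi\<close> and \<open>cs pi\<close> determine
  the potential by Bennewitz' proof of the Borg-Marchenko theorem.\<close>

section \<open>Entire functions with comparable zeros\<close>

text \<open>The known zeros of the difference of the two functions \<open>cs pi\<close> are only a
  perturbation of the \<open>b j\<close>, so the difference need not be divisible by
  \<open>cs pi\<close>, and comparing canonical products would call for growth theory and eigenvalue
  asymptotics. Blaschke products of the zeros in one disc at a time replace both: at the centre they
  depend on the moduli of the zeros alone, and absolute convergence of the product of the
  \<open>a (k n) / b (l n)\<close> keeps the relevant ratio of moduli bounded as the disc grows.
  Positivity of the spectra makes 0 available as the centre. The masses enter because the derivative
  of \<open>sn pi\<close> in the spectral parameter is, at an eigenvalue, \<open>cs pi\<close> times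
  the squared norm of the eigenfunction. For a merely integrable potential second derivatives exist
  only almost everywhere; differential equations are therefore kept in integrated form, and most
  facts about solutions are drawn from one Lagrange identity.\<close>

lemma maximum_modulus_sphere:
  assumes "f holomorphic_on cball 0 R" "\<And>z. norm z = R \<Longrightarrow> norm (f z) \<le> B" "norm \<xi> \<le> R"
  shows "norm (f \<xi>) \<le> (B::real)"
proof (rule maximum_modulus_frontier[of f "cball 0 R"])
  show "f holomorphic_on interior (cball 0 R)"
    using assms(1) by (rule holomorphic_on_subset) auto
  show "continuous_on (closure (cball 0 R)) f"
    using holomorphic_on_imp_continuous_on[OF assms(1)] by simp
qed (use assms in auto)

text \<open>The maximum principle carries the bound from each circle to every point inside it, so a
  single sequence of growing circles suffices.\<close>

lemma entire_eq_0_if_small_on_circles: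
  assumes "f holomorphic_on UNIV" and R: "filterlim R at_top sequentially"
    and \<epsilon>: "\<epsilon> \<longlonglongrightarrow> (0::real)"
    and bd: "\<forall>\<^sub>F N in sequentially. \<forall>z. norm z = R N \<longrightarrow> norm (f z) \<le> \<epsilon> N"
  shows "f \<xi> = 0"
proof -
  have "\<forall>\<^sub>F N in sequentially. norm \<xi> \<le> R N"
    by (rule eventually_compose_filterlim[OF eventually_ge_at_top R])
  then have "\<forall>\<^sub>F N in sequentially. norm (f \<xi>) \<le> \<epsilon> N"
    using bd
  proof eventually_elim
    case (elim N)
    then show ?case
      using maximum_modulus_sphere[of f "R N" "\<epsilon> N" \<xi>] holomorphic_on_subset[OF assms(1), of "cball 0 (R N)"]
      by auto
  qed
  then have "norm (f \<xi>) \<le> 0"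
    by (intro tendsto_lowerbound[OF \<epsilon>]) auto
  then show ?thesis by simp
qed

lemma entire_divide_zero:
  fixes g :: "complex \<Rightarrow> complex"
  assumes "g holomorphic_on UNIV" "g p = 0"
  obtains g1 where "g1 holomorphic_on UNIV" "\<And>z. g z = (z - p) * g1 z"
proof
  let ?g1 = "\<lambda>z. if z = p then deriv g p else (g z - g p) / (z - p)"
  show "?g1 holomorphic_on UNIV"
    using assms by (intro pole_lemma_open) auto
  show "g z = (z - p) * ?g1 z" for z
    using assms by auto
qed

text \<open>Distinct zeros can be removed one after the other, because the factors already split off
  do not vanish at the next point.\<close>

lemma entire_divide_zeros:
  fixes g :: "complex \<Rightarrow> complex"
  assumes "g holomorphic_on UNIV" "finite T" "\<And>p. p \<in> T \<Longrightarrow> g p = 0"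
  obtains g1 where "g1 holomorphic_on UNIV" "\<And>z. g z = (\<Prod>p\<in>T. z - p) * g1 z"
proof -
  have "\<exists>g1. g1 holomorphic_on UNIV \<and> (\<forall>z. g z = (\<Prod>p\<in>T. z - p) * g1 z)"
    using assms(2,3)
  proof (induction T)
    case empty
    then show ?case using assms(1) by (intro exI[of _ g]) simp
  next
    case (insert p T)
    then obtain g1 where g1: "g1 holomorphic_on UNIV" "\<And>z. g z = (\<Prod>p\<in>T. z - p) * g1 z"
      by blast
    have "(\<Prod>q\<in>T. p - q) \<noteq> 0"
      using insert.hyps by (auto simp: prod_zero_iff)
    moreover have "(\<Prod>q\<in>T. p - q) * g1 p = 0"
      using g1(2)[of p] insert.prems[of p] by simp
    ultimately have "g1 p = 0"
      by simp
    then obtain g2 where "g2 holomorphic_on UNIV" "\<And>z. g1 z = (z - p) * g2 z"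
      using entire_divide_zero g1(1) by blast
    then show ?case
      using g1(2) insert.hyps by (intro exI[of _ g2]) (simp add: mult.assoc mult.left_commute)
  qed
  then show ?thesis using that by blast
qed

text \<open>Zeros will be compared by evaluating at the centre 0, where the function in question may
  itself vanish; its order there is split off beforehand.\<close>

lemma entire_divide_order:
  fixes D :: "complex \<Rightarrow> complex"
  assumes D: "D holomorphic_on UNIV" "D z0 \<noteq> 0"
  obtains m E where "E holomorphic_on UNIV" "\<And>z. D z = z ^ m * E z" "E 0 \<noteq> 0"
proof (cases "D 0 = 0")
  case False
  with D that[of D 0] show ?thesis by auto
next
  case True
  have "\<not> D constant_on UNIV"
    using True D(2) by (metis UNIV_I constant_on_def)
  note factor = holomorphic_factor_zero_nonconstant[OF D(1) open_UNIV connected_UNIV UNIV_I True this]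
  obtain g r n where g: "0 < n" "0 < r" "g holomorphic_on ball 0 r"
      "\<And>w. w \<in> ball 0 r \<Longrightarrow> D w = (w - 0)^n * g w" "\<And>w. w \<in> ball 0 r \<Longrightarrow> g w \<noteq> 0"
    by (rule factor) (rule that)
  define E where "E z = (if z = 0 then g 0 else D z / z ^ n)" for z
  have "E holomorphic_on ball 0 r"
    using g(3) by (rule holomorphic_transform) (use g in \<open>auto simp: E_def\<close>)
  moreover have "(\<lambda>z. D z / z ^ n) holomorphic_on -{0}"
    by (intro holomorphic_intros holomorphic_on_subset[OF D(1)]) auto
  then have "E holomorphic_on -{0}"
    by (rule holomorphic_transform) (auto simp: E_def)
  ultimately have "E holomorphic_on ball 0 r \<union> -{0}"
    by (intro holomorphic_on_Un) auto
  also have "ball 0 r \<union> -{0} = (UNIV :: complex set)"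
    using g by auto
  finally have "E holomorphic_on UNIV" .
  moreover have "D z = z ^ n * E z" for z
    using g True by (auto simp: E_def)
  moreover have "E 0 \<noteq> 0"
    using g by (auto simp: E_def)
  ultimately show ?thesis using that by blast
qed

section \<open>Comparing the zeros in a disc\<close>

lemma entire_finite_zeros:
  fixes f :: "complex \<Rightarrow> complex" and b :: "nat \<Rightarrow> real"
  assumes f: "f holomorphic_on UNIV" "f z0 \<noteq> 0"
    and b: "inj b" "\<And>n. f (of_real (b n)) = 0"
  shows "finite {n. \<bar>b n\<bar> \<le> R}"
proof -
  have "\<not> f constant_on UNIV"
    using b(2)[of 0] f(2) by (metis UNIV_I constant_on_def)
  then have "finite {z\<in>cball 0 R. f z = 0}"
    by (intro holomorphic_compact_finite_zeros[OF f(1)]) auto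
  then have "finite ((\<lambda>n. complex_of_real (b n)) ` {n. \<bar>b n\<bar> \<le> R})"
    by (rule finite_subset[rotated]) (use b in auto)
  then show ?thesis
    by (rule finite_imageD) (use b in \<open>auto simp: inj_on_def\<close>)
qed

text \<open>Truncation at \<open>R\<close> handles the indices for which only one of
  \<open>b n\<close> and \<open>w n\<close> lies in the disc: the outer one contributes just
  \<open>R\<close>, so both products run over the same set. Each quotient of truncated values is at
  most the larger of 1 and \<open>w n / b n\<close>, hence at most
  \<open>exp \<bar>w n / b n - 1\<bar>\<close>.\<close>

lemma prod_min_le:
  fixes b w :: "nat \<Rightarrow> real"
  assumes "finite F" "0 < R" "\<And>n. 0 < b n" "\<And>n. 0 < w n" "(\<Sum>n\<in>F. \<bar>w n / b n - 1\<bar>) \<le> M"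
  shows "(\<Prod>n\<in>F. min (w n) R) \<le> exp M * (\<Prod>n\<in>F. min (b n) R)"
proof -
  have *: "min (w n) R \<le> exp \<bar>w n / b n - 1\<bar> * min (b n) R" for n
  proof (cases "w n \<le> b n")
    case True
    then have "min (w n) R \<le> 1 * min (b n) R" by auto
    also have "\<dots> \<le> exp \<bar>w n / b n - 1\<bar> * min (b n) R"
      using assms(2) assms(3)[of n] by (intro mult_right_mono) auto
    finally show ?thesis .
  next
    case False
    have "min (w n) R \<le> w n / b n * min (b n) R"
    proof (cases "b n \<le> R")
      case True
      then show ?thesis using assms(3)[of n] by auto
    next
      case False
      then show ?thesis using \<open>\<not> w n \<le> b n\<close> assms(3)[of n] \<open>0 < R\<close> by (auto simp: field_simps)
    qed
    also have "w n / b n \<le> exp (w n / b n - 1)"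
      using exp_ge_add_one_self[of "w n / b n - 1"] by simp
    also have "\<dots> \<le> exp \<bar>w n / b n - 1\<bar>" by simp
    finally show ?thesis
      using assms(2) assms(3)[of n] by (auto simp: mult_right_mono)
  qed
  have "(\<Prod>n\<in>F. min (w n) R) \<le> (\<Prod>n\<in>F. exp \<bar>w n / b n - 1\<bar> * min (b n) R)"
    by (intro prod_mono) (use assms(2-4) * in \<open>auto simp: less_imp_le\<close>)
  also have "\<dots> = exp (\<Sum>n\<in>F. \<bar>w n / b n - 1\<bar>) * (\<Prod>n\<in>F. min (b n) R)"
    by (simp add: prod.distrib exp_sum assms(1))
  also have "\<dots> \<le> exp M * (\<Prod>n\<in>F. min (b n) R)"
    using assms(2,3,5) by (intro mult_right_mono prod_nonneg) (auto simp: less_imp_le)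
  finally show ?thesis .
qed

text \<open>On the circle \<open>z * cnj z\<close> is the square of \<open>R\<close>, which makes
  the Blaschke factor of the real point \<open>p\<close> unimodular. In this division-free form,
  \<open>z - p\<close> can be traded there for a factor whose zero is the reflection of
  \<open>p\<close> in the circle.\<close>

lemma norm_Blaschke_circle:
  fixes z :: complex
  assumes "norm z = R"
  shows "norm (of_real (R\<^sup>2) - of_real p * z) = R * norm (z - of_real p)"
proof -
  have "z * cnj z = of_real (R\<^sup>2)"
    using assms by (simp add: complex_norm_square[symmetric])
  then have "of_real (R\<^sup>2) - of_real p * z = z * cnj (z - of_real p)"
    by (simp add: algebra_simps)
  then show ?thesis
    using assms by (simp only: norm_mult complex_mod_cnj)
qed

text \<open>Dividing \<open>D / f\<close> by the Blaschke products of the zeros in a disc and applying the maximum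
  principle at the centre bounds \<open>D 0\<close>: moving each zero \<open>b n\<close> to \<open>w n\<close> changes the
  product of the moduli of the zeros by a bounded factor only.\<close>

lemma entire_eq_0_if_comparable_zeros:
  fixes f D :: "complex \<Rightarrow> complex" and b w :: "nat \<Rightarrow> real"
  assumes f: "f holomorphic_on UNIV" "\<And>z. f z = 0 \<longleftrightarrow> (\<exists>n. z = of_real (b n))"
    and simple: "\<And>n. deriv f (of_real (b n)) \<noteq> 0"
    and b: "inj b" "\<And>n. 0 < b n"
    and D: "D holomorphic_on UNIV" "\<And>n. D (of_real (w n)) = 0"
    and w: "inj w" "\<And>n. 0 < w n"
    and M: "\<And>F. finite F \<Longrightarrow> (\<Sum>n\<in>F. \<bar>w n / b n - 1\<bar>) \<le> M"
    and R: "filterlim R at_top sequentially"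
    and \<epsilon>: "\<epsilon> \<longlonglongrightarrow> (0::real)"
    and bd: "\<forall>\<^sub>F N in sequentially. \<forall>z. norm z = R N \<longrightarrow> f z \<noteq> 0 \<and> norm (D z) \<le> \<epsilon> N * norm (f z)"
  shows "D \<xi> = 0"
proof (rule ccontr)
  assume D0: "D \<xi> \<noteq> 0"
  obtain m E where E: "E holomorphic_on UNIV" "\<And>z. D z = z ^ m * E z" "E 0 \<noteq> 0"
    using entire_divide_order[OF D(1) D0] by metis
  have Ew: "E (of_real (w n)) = 0" for n
    using D(2)[of n] E(2)[of "of_real (w n)"] w(2)[of n] by auto
  have f0: "f 0 \<noteq> 0"
    using f(2)[of 0] b(2) by (metis less_irrefl of_real_eq_0_iff)
  have fb: "f (of_real (b n)) = 0" for n
    using f(2) by blast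
  have abs: "\<bar>b n\<bar> = b n" "\<bar>w n\<bar> = w n" for n
    using b(2)[of n] w(2)[of n] by auto
  have fin: "finite {n. b n \<le> r}" "finite {n. w n \<le> r}" for r
    using entire_finite_zeros[OF f(1) f0 b(1) fb, of r] entire_finite_zeros[OF E(1) E(3) w(1) Ew, of r]
    by (simp_all only: abs)
  \<comment> \<open>Apart from \<open>\<epsilon> N\<close> nothing on the right depends on
    \<open>N\<close>, so letting \<open>N\<close> grow forces \<open>E 0 = 0\<close>.\<close>
  have main: "norm (E 0) \<le> \<epsilon> N * norm (f 0) * exp M"
    if r: "R N \<ge> 1" and bdN: "\<And>z. norm z = R N \<Longrightarrow> f z \<noteq> 0 \<and> norm (D z) \<le> \<epsilon> N * norm (f z)" for N
  proof -
    define r where "r = R N"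
    define S where "S = {n. b n \<le> r}"
    define T where "T = {n. w n \<le> r}"
    have finST: "finite S" "finite T"
      using fin by (auto simp: S_def T_def)
    have r0: "r > 0" using r by (simp add: r_def)
    let ?cb = "\<lambda>n. complex_of_real (b n)"
    let ?cw = "\<lambda>n. complex_of_real (w n)"
    have inj: "inj_on ?cb S" "inj_on ?cw T"
      using b(1) w(1) by (auto simp: inj_on_def)
    obtain E1 where E1: "E1 holomorphic_on UNIV" "\<And>z. E z = (\<Prod>n\<in>T. z - ?cw n) * E1 z"
      using entire_divide_zeros[OF E(1), of "?cw ` T"] Ew finST inj(2)
      by (auto simp: prod.reindex)
    obtain f1 where f1: "f1 holomorphic_on UNIV" "\<And>z. f z = (\<Prod>n\<in>S. z - ?cb n) * f1 z"
      using entire_divide_zeros[OF f(1), of "?cb ` S"] fb finST inj(1)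
      by (auto simp: prod.reindex)
    \<comment> \<open>Simplicity of the zeros enters here: a zero of \<open>f\<close> in the disc
      that survived the division by its linear factor would be a double zero.\<close>
    have f1nz: "f1 z \<noteq> 0" if z: "norm z \<le> r" for z
    proof
      assume f1z: "f1 z = 0"
      then have "f z = 0" using f1(2)[of z] by simp
      then obtain n where n: "z = ?cb n" using f(2) by blast
      then have "n \<in> S" using z b(2)[of n] by (auto simp: S_def)
      let ?P = "\<lambda>z. (\<Prod>n\<in>S. z - ?cb n)"
      have P0: "?P z = 0"
        using \<open>n \<in> S\<close> n finST by auto
      have "?P holomorphic_on UNIV"
        by (intro holomorphic_intros)
      then have "(?P has_field_derivative deriv ?P z) (at z)"
        by (intro holomorphic_derivI[of _ UNIV]) auto
      moreover have "(f1 has_field_derivative deriv f1 z) (at z)"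
        using f1(1) by (intro holomorphic_derivI[of _ UNIV]) auto
      ultimately have "((\<lambda>z. ?P z * f1 z) has_field_derivative (deriv ?P z * f1 z + deriv f1 z * ?P z)) (at z)"
        by (rule DERIV_mult)
      moreover have "(\<lambda>z. ?P z * f1 z) = f" using f1(2) by auto
      ultimately have "(f has_field_derivative 0) (at z)"
        using f1z P0 by simp
      then have "deriv f z = 0" by (rule DERIV_imp_deriv)
      then show False using simple n by auto
    qed
    \<comment> \<open>This is \<open>E / f\<close> with every linear factor of a zero in the disc
      replaced by its reflected factor. The modulus on the circle is unchanged, the quotient becomes
      holomorphic inside, and each new factor equals \<open>r\<close> at the centre.\<close>
    define h where "h z = E1 z * (\<Prod>n\<in>T. (of_real (r\<^sup>2) - of_real (w n) * z) / of_real r) /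
        (f1 z * (\<Prod>n\<in>S. (of_real (r\<^sup>2) - of_real (b n) * z) / of_real r))" for z
    \<comment> \<open>As \<open>f\<close> has no zero on the circle, the reflected points of the
      \<open>b n\<close> with \<open>n \<in> S\<close> lie strictly outside the closed disc, and the
      denominator of \<open>h\<close> cannot vanish.\<close>
    have bnr: "b n \<noteq> r" for n
      using bdN[of "of_real r"] fb[of n] r0 by (auto simp: r_def)
    have hol: "h holomorphic_on cball 0 r"
      unfolding h_def
    proof (intro holomorphic_intros holomorphic_on_subset[OF E1(1)] holomorphic_on_subset[OF f1(1)])
      fix z :: complex assume "z \<in> cball 0 r"
      then have z: "norm z \<le> r" by simp
      have "of_real (r\<^sup>2) - of_real (b n) * z \<noteq> 0" if "n \<in> S" for n
      proof
        assume "of_real (r\<^sup>2) - of_real (b n) * z = 0"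
        then have "complex_of_real (r\<^sup>2) = of_real (b n) * z" by simp
        then have "norm (complex_of_real (r\<^sup>2)) = norm (of_real (b n) * z)" by (simp only:)
        then have "r\<^sup>2 = b n * norm z"
          using b(2)[of n] by (simp add: norm_mult norm_power)
        also have "\<dots> \<le> b n * r" using z b(2)[of n] by (intro mult_left_mono) auto
        also have "\<dots> < r * r" using r0 bnr[of n] that by (auto simp: S_def)
        finally show False by (simp add: power2_eq_square)
      qed
      then show "f1 z * (\<Prod>n\<in>S. (of_real (r\<^sup>2) - of_real (b n) * z) / of_real r) \<noteq> 0"
        using f1nz[OF z] finST r0 by auto
    qed (use r0 in auto)
    have circ: "norm (h z) \<le> \<epsilon> N" if z: "norm z = r" for z
    proof -
      have fz: "f z \<noteq> 0" "norm (D z) \<le> \<epsilon> N * norm (f z)"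
        using bdN[of z] z by (auto simp: r_def)
      have "norm ((of_real (r\<^sup>2) - of_real p * z) / of_real r) = norm (z - of_real p)" for p
        using norm_Blaschke_circle[OF z, of p] r0 by (simp add: norm_divide)
      then have "norm (h z) = norm (E z) / norm (f z)"
        unfolding h_def E1(2) f1(2) by (simp add: norm_mult norm_divide prod_norm[symmetric] mult.commute)
      \<comment> \<open>Dropping the factor \<open>z ^ m\<close> cannot increase the modulus, since
        the radius is at least 1.\<close>
      also have "norm (E z) \<le> norm (D z)"
      proof -
        have "1 * norm (E z) \<le> r ^ m * norm (E z)"
          using r by (intro mult_right_mono) (auto simp: r_def)
        then show ?thesis using E(2)[of z] z by (simp add: norm_mult norm_power)
      qed
      then have "norm (E z) / norm (f z) \<le> norm (D z) / norm (f z)"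
        by (intro divide_right_mono) auto
      also have "\<dots> \<le> \<epsilon> N"
        using fz by (simp add: field_simps)
      finally show ?thesis .
    qed
    have "norm (h 0) \<le> \<epsilon> N"
      by (rule maximum_modulus_sphere[OF hol circ]) (use r0 in auto)
    moreover have "h 0 = E1 0 * of_real r ^ card T / (f1 0 * of_real r ^ card S)"
      using r0 by (simp add: h_def power2_eq_square)
    ultimately have h0: "norm (E1 0) * r ^ card T \<le> \<epsilon> N * (norm (f1 0) * r ^ card S)"
      using r0 f1nz[of 0] by (simp add: norm_mult norm_divide norm_power field_simps)
    have \<epsilon>0: "\<epsilon> N \<ge> 0"
      using order_trans[OF norm_ge_zero circ[of "of_real r"]] r0 by simp
    \<comment> \<open>For indices in \<open>S - T\<close> the moved zero has left the disc and is
      truncated to \<open>r\<close>.\<close>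
    have prT: "(\<Prod>n\<in>S \<union> T. min (w n) r) = (\<Prod>n\<in>T. w n) * r ^ card (S - T)"
    proof -
      have "S \<union> T = T \<union> (S - T)" by auto
      then have "(\<Prod>n\<in>S \<union> T. min (w n) r) = (\<Prod>n\<in>T. min (w n) r) * (\<Prod>n\<in>S-T. min (w n) r)"
        using finST by (metis Diff_disjoint finite_Diff prod.union_disjoint)
      moreover have "(\<Prod>n\<in>T. min (w n) r) = (\<Prod>n\<in>T. w n)"
        by (intro prod.cong) (auto simp: T_def)
      moreover have "(\<Prod>n\<in>S-T. min (w n) r) = (\<Prod>n\<in>S-T. r)"
        by (intro prod.cong) (auto simp: T_def)
      ultimately show ?thesis by simp
    qed
    have prS: "(\<Prod>n\<in>S \<union> T. min (b n) r) = (\<Prod>n\<in>S. b n) * r ^ card (T - S)"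
    proof -
      have "S \<union> T = S \<union> (T - S)" by auto
      then have "(\<Prod>n\<in>S \<union> T. min (b n) r) = (\<Prod>n\<in>S. min (b n) r) * (\<Prod>n\<in>T-S. min (b n) r)"
        using finST by (metis Diff_disjoint finite_Diff prod.union_disjoint)
      moreover have "(\<Prod>n\<in>S. min (b n) r) = (\<Prod>n\<in>S. b n)"
        by (intro prod.cong) (auto simp: S_def)
      moreover have "(\<Prod>n\<in>T-S. min (b n) r) = (\<Prod>n\<in>T-S. r)"
        by (intro prod.cong) (auto simp: S_def)
      ultimately show ?thesis by simp
    qed
    have ineq: "(\<Prod>n\<in>T. w n) * r ^ card (S - T) \<le> exp M * ((\<Prod>n\<in>S. b n) * r ^ card (T - S))"
      using prod_min_le[of "S \<union> T" r b w M] finST r0 b(2) w(2) M[of "S \<union> T"]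
      by (simp add: prT prS)
    have cards: "card S = card (S \<inter> T) + card (S - T)" "card T = card (S \<inter> T) + card (T - S)"
      using finST by (auto simp: card_Diff_subset_Int Int_commute card_mono)
    have nE: "norm (E 0) = (\<Prod>n\<in>T. w n) * norm (E1 0)"
      using E1(2)[of 0] w(2) by (simp add: norm_mult prod_norm[symmetric] less_imp_le)
    have nf: "norm (f 0) = (\<Prod>n\<in>S. b n) * norm (f1 0)"
      using f1(2)[of 0] b(2) by (simp add: norm_mult prod_norm[symmetric] less_imp_le)
    have "norm (E 0) * r ^ card (S - T) * r ^ card T
        = ((\<Prod>n\<in>T. w n) * r ^ card (S - T)) * (norm (E1 0) * r ^ card T)"
      by (simp add: nE)
    also have "\<dots> \<le> (exp M * ((\<Prod>n\<in>S. b n) * r ^ card (T - S))) * (\<epsilon> N * (norm (f1 0) * r ^ card S))"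
      using r0 b(2) by (intro mult_mono ineq h0 mult_nonneg_nonneg prod_nonneg) (auto simp: less_imp_le)
    also have "\<dots> = (\<epsilon> N * norm (f 0) * exp M) * (r ^ card (T - S) * r ^ card S)"
      by (simp add: nf)
    finally have "norm (E 0) * (r ^ card (S - T) * r ^ card T) \<le>
        (\<epsilon> N * norm (f 0) * exp M) * (r ^ card (T - S) * r ^ card S)"
      by (simp add: mult.assoc)
    \<comment> \<open>Both exponents add up to \<open>card (S \<union> T)\<close>. Hence the powers
      of \<open>r\<close> cancel even when the disc contains different numbers of old and new
      zeros.\<close>
    moreover have "r ^ card (S - T) * r ^ card T = r ^ card (T - S) * r ^ card S"
      by (simp add: cards power_add[symmetric] ac_simps)
    ultimately have "norm (E 0) * (r ^ card (T - S) * r ^ card S) \<le>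
        (\<epsilon> N * norm (f 0) * exp M) * (r ^ card (T - S) * r ^ card S)"
      by (simp only:)
    then show ?thesis
      by (rule mult_right_le_imp_le) (use r0 in simp)
  qed
  have "\<forall>\<^sub>F N in sequentially. R N \<ge> 1"
    by (rule eventually_compose_filterlim[OF eventually_ge_at_top R])
  then have "\<forall>\<^sub>F N in sequentially. norm (E 0) \<le> \<epsilon> N * norm (f 0) * exp M"
    using bd by eventually_elim (use main in auto)
  moreover have "(\<lambda>N. \<epsilon> N * norm (f 0) * exp M) \<longlonglongrightarrow> 0 * norm (f 0) * exp M"
    by (intro tendsto_intros \<epsilon>)
  ultimately have "norm (E 0) \<le> 0 * norm (f 0) * exp M"
    by (intro tendsto_lowerbound[of "\<lambda>N. \<epsilon> N * norm (f 0) * exp M" _ sequentially]) auto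
  then show False using E(3) by simp
qed

section \<open>Absolutely continuous functions\<close>

lemma absolutely_integrable_subinterval:
  fixes f :: "real \<Rightarrow> 'a::euclidean_space"
  assumes "f absolutely_integrable_on {a..b}" "a \<le> c" "d \<le> b"
  shows "f absolutely_integrable_on {c..d}"
  by (rule set_integrable_subset[OF assms(1)]) (use assms in auto)

lemma absolutely_integrable_mult_continuous:
  fixes p u :: "real \<Rightarrow> complex"
  assumes "p absolutely_integrable_on {a..b}" "continuous_on {a..b} u"
  shows "(\<lambda>t. p t * u t) absolutely_integrable_on {a..b}"
proof (rule absolutely_integrable_bounded_measurable_product[of "\<lambda>x y. y * x" u _ p])
  show "bilinear (\<lambda>x y::complex. y * x)"
    by (auto simp: bilinear_def linear_iff algebra_simps)
  show "u \<in> borel_measurable (lebesgue_on {a..b})"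
    using assms(2) by (intro continuous_imp_measurable_on_sets_lebesgue) auto
  show "bounded (u ` {a..b})"
    using assms(2) by (intro compact_imp_bounded compact_continuous_image) auto
qed (use assms in auto)

lemma integral_diff_interval:
  fixes f :: "real \<Rightarrow> 'a::euclidean_space"
  assumes "f integrable_on {a..b}" "a \<le> x" "x \<le> y" "y \<le> b"
  shows "integral {a..y} f - integral {a..x} f = integral {x..y} f"
  using Henstock_Kurzweil_Integration.integral_combine[of a x y f]
    integrable_on_subinterval[OF assms(1), of a y] assms by (auto simp: algebra_simps)

text \<open>The difference quotient is at most \<open>C * \<bar>G y - G x\<bar>\<close>, which tends
  to 0 by mere continuity of \<open>G\<close>.\<close>

lemma has_vector_derivative_0_if_mult_small:
  fixes H :: "real \<Rightarrow> complex"
  assumes bd: "\<And>x y. x \<in> S \<Longrightarrow> y \<in> S \<Longrightarrow> x \<le> y \<Longrightarrow> norm (H y - H x) \<le> C * (y - x) * \<bar>G y - G x\<bar>"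
    and G: "continuous_on S G" and x: "x \<in> S"
  shows "(H has_vector_derivative 0) (at x within S)"
proof -
  have lim: "((\<lambda>y. C * \<bar>G y - G x\<bar>) \<longlongrightarrow> C * \<bar>G x - G x\<bar>) (at x within S)"
    using G x by (intro tendsto_intros) (auto simp: continuous_on_def)
  have "((\<lambda>y. (H y - H x) /\<^sub>R norm (y - x)) \<longlongrightarrow> 0) (at x within S)"
  proof (rule Lim_null_comparison)
    show "((\<lambda>y. C * \<bar>G y - G x\<bar>) \<longlongrightarrow> 0) (at x within S)"
      using lim by simp
    have *: "norm (H y - H x) \<le> C * \<bar>y - x\<bar> * \<bar>G y - G x\<bar>" if "y \<in> S" for y
      using bd[of x y] bd[of y x] x that
      by (cases "x \<le> y") (auto simp: norm_minus_commute abs_minus_commute)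
    show "\<forall>\<^sub>F y in at x within S. norm ((H y - H x) /\<^sub>R norm (y - x)) \<le> C * \<bar>G y - G x\<bar>"
      unfolding eventually_at_filter
    proof (intro always_eventually allI impI)
      fix y assume "y \<noteq> x" "y \<in> S"
      have "norm ((H y - H x) /\<^sub>R norm (y - x)) = norm (H y - H x) / \<bar>y - x\<bar>"
        by (simp add: divide_inverse mult.commute)
      also have "\<dots> \<le> C * \<bar>G y - G x\<bar>"
        using *[OF \<open>y \<in> S\<close>] \<open>y \<noteq> x\<close> by (simp add: divide_le_eq mult.commute mult.left_commute)
      finally show "norm ((H y - H x) /\<^sub>R norm (y - x)) \<le> C * \<bar>G y - G x\<bar>" .
    qed
  qed
  then show ?thesis
    by (simp add: has_vector_derivative_def has_derivative_within inverse_eq_divide)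
qed

text \<open>The difference of the two sides has increments of size
  \<open>O((y - x) * (G y - G x))\<close> with \<open>G\<close> the indefinite integral of \<open>norm \<circ> g\<close>, hence derivative 0
  everywhere; so Lebesgue's differentiation theorem is not needed.\<close>

lemma product_rule_AC:
  fixes f g v v' :: "real \<Rightarrow> complex"
  assumes g: "g absolutely_integrable_on {a..b}"
    and f: "\<And>x. x \<in> {a..b} \<Longrightarrow> f x = f a + integral {a..x} g"
    and v: "\<And>x. x \<in> {a..b} \<Longrightarrow> (v has_vector_derivative v' x) (at x within {a..b})"
    and v': "continuous_on {a..b} v'"
    and x: "x \<in> {a..b}"
  shows "f x * v x = f a * v a + integral {a..x} (\<lambda>t. g t * v t + f t * v' t)"
proof -
  have gi: "g integrable_on {a..b}" and gn: "(\<lambda>t. norm (g t)) integrable_on {a..b}"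
    using g by (auto simp: absolutely_integrable_on_def)
  have vc: "continuous_on {a..b} v"
    by (rule continuous_on_vector_derivative[OF v])
  have fc: "continuous_on {a..b} f"
  proof -
    have "continuous_on {a..b} (\<lambda>x. f a + integral {a..x} g)"
      by (rule continuous_on_add[OF continuous_on_const indefinite_integral_continuous_1[OF gi]])
    then show ?thesis
      by (rule continuous_on_eq) (rule f[symmetric])
  qed
  have fint: "f y - f x = integral {x..y} g" if "x \<in> {a..b}" "y \<in> {a..b}" "x \<le> y" for x y
    using integral_diff_interval[OF gi, of x y] that f[of x] f[of y] by (simp add: algebra_simps)
  define G where "G x = integral {a..x} (\<lambda>t. norm (g t))" for x
  have Gc: "continuous_on {a..b} G"
    unfolding G_def by (rule indefinite_integral_continuous_1[OF gn])
  have "bounded (v' ` {a..b})"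
    by (intro compact_imp_bounded compact_continuous_image v') auto
  then obtain M where M0: "M > 0" and "\<forall>y\<in>v' ` {a..b}. norm y \<le> M"
    unfolding bounded_pos by blast
  then have M: "\<And>t. t \<in> {a..b} \<Longrightarrow> norm (v' t) \<le> M"
    by blast
  have gv: "(\<lambda>t. g t * v t) integrable_on {a..b}"
    using absolutely_integrable_mult_continuous[OF g vc] by (simp add: absolutely_integrable_on_def)
  have fv: "(\<lambda>t. f t * v' t) integrable_on {a..b}"
    by (intro integrable_continuous_real continuous_intros fc v')
  define H where "H x = f x * v x - integral {a..x} (\<lambda>t. g t * v t + f t * v' t)" for x
  have incr: "norm (H y - H x) \<le> 2 * M * (y - x) * \<bar>G y - G x\<bar>"
    if xy: "x \<in> {a..b}" "y \<in> {a..b}" "x \<le> y" for x y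
  proof -
    have sub: "h integrable_on {x..y}" if "h integrable_on {a..b}" for h :: "real \<Rightarrow> 'c::banach"
      using integrable_on_subinterval[OF that, of x y] xy by auto
    have Gxy: "G y - G x = integral {x..y} (\<lambda>t. norm (g t))"
      unfolding G_def using xy by (intro integral_diff_interval[OF gn]) auto
    have G0: "G y - G x \<ge> 0"
      unfolding Gxy by (intro integral_nonneg sub gn) auto
    have fdiff: "norm (f t - f x) \<le> G y - G x" if t: "t \<in> {x..y}" for t
    proof -
      have "f t - f x = integral {x..t} g"
        using xy t by (intro fint) auto
      also have "norm \<dots> \<le> integral {x..t} (\<lambda>t. norm (g t))"
        using xy t by (intro Henstock_Kurzweil_Integration.integral_norm_bound_integral)
          (auto intro: integrable_on_subinterval[OF gi] integrable_on_subinterval[OF gn])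
      also have "\<dots> \<le> integral {x..y} (\<lambda>t. norm (g t))"
        using xy t by (intro integral_subset_le)
          (auto intro: integrable_on_subinterval[OF gi] integrable_on_subinterval[OF gn])
      finally show ?thesis by (simp add: Gxy)
    qed
    have vint: "v y - v t = integral {t..y} v'" if t: "t \<in> {x..y}" for t
    proof -
      have "(v' has_integral v y - v t) {t..y}"
        using t xy by (intro fundamental_theorem_of_calculus has_vector_derivative_within_subset[OF v]) auto
      then show ?thesis by (simp add: integral_unique)
    qed
    have vdiff: "norm (v y - v t) \<le> M * (y - x)" if t: "t \<in> {x..y}" for t
    proof -
      have "norm (v y - v t) \<le> M * (y - t)"
        unfolding vint[OF t] using t xy M
        by (intro integral_bound) (auto intro: continuous_on_subset[OF v'])
      also have "\<dots> \<le> M * (y - x)" using t M0 by (intro mult_left_mono) auto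
      finally show ?thesis .
    qed
    have i1: "(\<lambda>t. g t * (v y - v t)) integrable_on {x..y}"
    proof -
      have "(\<lambda>t. g t * v y - g t * v t) integrable_on {x..y}"
        by (intro integrable_diff integrable_on_mult_left sub gv gi)
      then show ?thesis by (simp add: algebra_simps)
    qed
    have i2: "(\<lambda>t. (f t - f x) * v' t) integrable_on {x..y}"
      using xy by (intro integrable_continuous_real continuous_intros continuous_on_subset[OF fc]
        continuous_on_subset[OF v']) auto
    have "H y - H x = f y * v y - f x * v x - integral {x..y} (\<lambda>t. g t * v t + f t * v' t)"
      unfolding H_def
      using integral_diff_interval[OF integrable_add[OF gv fv], of x y] xy by (simp add: algebra_simps)
    \<comment> \<open>Freezing \<open>v\<close> at the right end and \<open>f\<close> at the left
      end makes this exact. What then remains of the increment of \<open>H\<close> has the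
      integrands \<open>g t * (v y - v t)\<close> and \<open>(f t - f x) * v' t\<close>; each
      integral is of second order, at most \<open>M * (y - x) * (G y - G x)\<close>.\<close>
    also have "f y * v y - f x * v x = integral {x..y} (\<lambda>t. g t * v y) + integral {x..y} (\<lambda>t. f x * v' t)"
    proof -
      have "f y - f x = integral {x..y} g"
        using xy by (intro fint) auto
      then have "integral {x..y} (\<lambda>t. g t * v y) + integral {x..y} (\<lambda>t. f x * v' t)
          = (f y - f x) * v y + f x * (v y - v x)"
        using vint[of x] xy by simp
      then show ?thesis by (simp add: algebra_simps)
    qed
    also have "integral {x..y} (\<lambda>t. g t * v y) + integral {x..y} (\<lambda>t. f x * v' t)
         - integral {x..y} (\<lambda>t. g t * v t + f t * v' t)
       = integral {x..y} (\<lambda>t. g t * (v y - v t)) - integral {x..y} (\<lambda>t. (f t - f x) * v' t)"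
    proof -
      have i3: "(\<lambda>t. g t * v y) integrable_on {x..y}" "(\<lambda>t. f x * v' t) integrable_on {x..y}"
        by (intro integrable_on_mult_left integrable_on_mult_right sub gi integrable_continuous_real v')+
      have i5: "(\<lambda>t. g t * v t + f t * v' t) integrable_on {x..y}"
        by (intro integrable_add sub gv fv)
      have "integral {x..y} (\<lambda>t. g t * v y) + integral {x..y} (\<lambda>t. f x * v' t)
           - integral {x..y} (\<lambda>t. g t * v t + f t * v' t)
         = integral {x..y} (\<lambda>t. g t * v y + f x * v' t - (g t * v t + f t * v' t))"
        by (simp only: integral_diff[OF integrable_add[OF i3] i5] integral_add[OF i3])
      also have "\<dots> = integral {x..y} (\<lambda>t. g t * (v y - v t) - (f t - f x) * v' t)"
        by (rule arg_cong[where f = "integral _"]) (auto simp: algebra_simps)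
      also have "\<dots> = integral {x..y} (\<lambda>t. g t * (v y - v t)) - integral {x..y} (\<lambda>t. (f t - f x) * v' t)"
        by (intro integral_diff i1 i2)
      finally show ?thesis .
    qed
    also have "norm \<dots> \<le> M * (y - x) * (G y - G x) + M * (y - x) * (G y - G x)"
    proof (rule order_trans[OF norm_triangle_ineq4 add_mono])
      have "norm (integral {x..y} (\<lambda>t. g t * (v y - v t))) \<le> integral {x..y} (\<lambda>t. norm (g t) * (M * (y - x)))"
        using vdiff by (intro Henstock_Kurzweil_Integration.integral_norm_bound_integral i1
          integrable_on_mult_left sub gn) (auto simp: norm_mult intro!: mult_left_mono)
      then show "norm (integral {x..y} (\<lambda>t. g t * (v y - v t))) \<le> M * (y - x) * (G y - G x)"
        by (simp add: Gxy mult.commute)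
      have "norm (integral {x..y} (\<lambda>t. (f t - f x) * v' t)) \<le> (G y - G x) * M * (y - x)"
        using fdiff M xy G0 by (intro integral_bound continuous_intros continuous_on_subset[OF fc]
        continuous_on_subset[OF v']) (auto simp: norm_mult intro!: mult_mono)
      then show "norm (integral {x..y} (\<lambda>t. (f t - f x) * v' t)) \<le> M * (y - x) * (G y - G x)"
        by (simp add: algebra_simps)
    qed
    finally show ?thesis using G0 by simp
  qed
  obtain c where c: "\<And>x. x \<in> {a..b} \<Longrightarrow> H x = c"
    using has_vector_derivative_zero_constant[of "{a..b}" H]
      has_vector_derivative_0_if_mult_small[OF incr Gc] by blast
  have "H x = H a"
    using c[of x] c[of a] x by auto
  then show ?thesis
    by (simp add: H_def algebra_simps)
qed

text \<open>The half-lines are an intersection-stable generator of the Borel sets, so a Dynkin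
  argument gives vanishing integrals over all Borel sets. A Lebesgue set differs from a Borel set by
  a null set only, and a function all of whose set integrals vanish is 0 almost everywhere.\<close>

lemma AE_eq_0_if_integral_atMost_eq_0:
  fixes h :: "real \<Rightarrow> 'a::euclidean_space"
  assumes h: "integrable lebesgue h" and 0: "\<And>x. (LINT t:{..x}|lebesgue. h t) = 0"
  shows "AE x in lebesgue. h x = 0"
proof (rule sigma_finite_measure.density_zero[OF _ h])
  show "sigma_finite_measure (lebesgue :: real measure)"
  proof
    show "\<exists>A::real set set. countable A \<and> A \<subseteq> sets lebesgue \<and> \<Union>A = space lebesgue \<and>
        (\<forall>a\<in>A. emeasure lebesgue a \<noteq> \<infinity>)"
    proof (intro exI[of _ "range (\<lambda>n. {- real n..real n})"] conjI)
      have "\<exists>n. - real n \<le> x \<and> x \<le> real n" for x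
        using real_arch_simple[of "\<bar>x\<bar>"] by (metis abs_le_iff minus_le_iff)
      then show "\<Union> (range (\<lambda>n. {- real n..real n})) = space lebesgue"
        by auto
    qed auto
  qed
  have int: "set_integrable lebesgue A h" if "A \<in> sets lebesgue" for A
    using h that unfolding set_integrable_def by (simp add: integrable_mult_indicator)
  \<comment> \<open>The total integral, a limit over growing half-lines, is what the complement case
    of the Dynkin argument uses.\<close>
  have UNIV0: "(LINT t|lebesgue. h t) = 0"
  proof -
    have "(\<lambda>n. LINT t:{..real n}|lebesgue. h t) \<longlonglongrightarrow> (LINT t:(\<Union>n. {..real n})|lebesgue. h t)"
      by (intro set_integral_cont_up int) (auto simp: incseq_def)
    moreover have "(\<Union>n. {..real n}) = UNIV"
      using real_arch_simple by auto
    ultimately have "(\<lambda>n::nat. 0) \<longlonglongrightarrow> (LINT t|lebesgue. h t)"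
      by (simp only: 0) (simp add: set_lebesgue_integral_def)
    then show ?thesis
      by (simp add: LIMSEQ_const_iff)
  qed
  have borel: "(LINT t:A|lebesgue. h t) = 0" if "A \<in> sets borel" for A
  proof -
    have "Int_stable (range (\<lambda>a::real. {..a}))" "range (\<lambda>a::real. {..a}) \<subseteq> Pow UNIV"
      "A \<in> sigma_sets UNIV (range (\<lambda>a::real. {..a}))"
      using that by (auto simp: Int_stable_def borel_eq_atMost)
    then show ?thesis
    proof (induction rule: sigma_sets_induct_disjoint)
      case (compl A)
      then have [measurable]: "A \<in> sets borel" by (simp add: borel_eq_atMost)
      then have A: "A \<in> sets lebesgue" by simp
      have "(LINT t:A \<union> (UNIV - A)|lebesgue. h t) = (LINT t:A|lebesgue. h t) + (LINT t:UNIV - A|lebesgue. h t)"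
        using A by (intro set_integral_Un int) auto
      then show ?case
        using compl UNIV0 by (simp add: set_lebesgue_integral_def)
    next
      case (union A)
      then have "A i \<in> sets borel" for i by (auto simp: borel_eq_atMost)
      then have A: "A i \<in> sets lebesgue" for i by simp
      have "(LINT t:(\<Union>i. A i)|lebesgue. h t) = (\<Sum>i. LINT t:A i|lebesgue. h t)"
        using union(1) A by (intro lebesgue_integral_countable_add int) (auto simp: disjoint_family_on_def)
      then show ?case using union by simp
    next
      case (basic A)
      then show ?case using 0 by auto
    qed (simp add: set_lebesgue_integral_def)
  qed
  fix A :: "real set" assume A: "A \<in> sets lebesgue"
  then obtain S N N' where S: "A = S \<union> N" "N \<subseteq> N'" "N' \<in> null_sets lborel" "S \<in> sets lborel"
    by (rule sets_completionE)
  have SL: "S \<in> sets lebesgue" using S(4) by simp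
  have "AE x in lebesgue. x \<notin> N'"
    using S(3) by (intro AE_not_in null_sets_completionI)
  then have "AE x in lebesgue. x \<in> S \<longleftrightarrow> x \<in> A"
    by eventually_elim (use S in auto)
  then have "(LINT t:A|lebesgue. h t) = (LINT t:S|lebesgue. h t)"
    using int[OF A] int[OF SL] unfolding set_integrable_def
    by (intro set_integral_cong_set) (auto simp: set_borel_measurable_def)
  then show "(LINT t:A|lebesgue. h t) = 0"
    using borel[of S] S(4) by simp
qed

lemma AE_eq_0_if_indefinite_integral_eq_0:
  fixes g :: "real \<Rightarrow> 'a::euclidean_space"
  assumes g: "g absolutely_integrable_on {a..b}" and 0: "\<And>x. x \<in> {a..b} \<Longrightarrow> integral {a..x} g = 0"
  shows "AE x in lebesgue. x \<in> {a..b} \<longrightarrow> g x = 0"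
proof -
  define h where "h x = indicator {a..b} x *\<^sub>R g x" for x
  have h: "integrable lebesgue h"
    using g unfolding set_integrable_def h_def .
  have "(LINT t:{..x}|lebesgue. h t) = 0" for x
  proof -
    have "(LINT t:{..x}|lebesgue. h t) = (LINT t:{a..min b x}|lebesgue. g t)"
      unfolding set_lebesgue_integral_def h_def
      by (intro Bochner_Integration.integral_cong) (auto simp: indicator_def)
    also have "\<dots> = integral {a..min b x} g"
      by (intro set_lebesgue_integral_eq_integral(2) absolutely_integrable_subinterval[OF g]) auto
    also have "\<dots> = 0"
      using 0[of "min b x"] by (cases "a \<le> min b x") auto
    finally show ?thesis .
  qed
  from AE_eq_0_if_integral_atMost_eq_0[OF h this] show ?thesis
    by eventually_elim (auto simp: h_def)
qed

section \<open>The initial value problem\<close>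

text \<open>The equation \<open>u'' = p u\<close> integrated once, with \<open>v\<close> in the role
  of \<open>u'\<close>. The coefficient is complex so that it can absorb the spectral parameter:
  potential \<open>q\<close> at \<open>z\<close> means \<open>p = q - z\<close>.\<close>

definition ode_solution :: "(real \<Rightarrow> complex) \<Rightarrow> (real \<Rightarrow> complex) \<Rightarrow> (real \<Rightarrow> complex) \<Rightarrow> bool" where
  "ode_solution p u v \<longleftrightarrow>
     (\<forall>x\<in>{0..pi}. (u has_vector_derivative v x) (at x within {0..pi})) \<and>
     (\<forall>x\<in>{0..pi}. v x = v 0 + integral {0..x} (\<lambda>t. p t * u t))"

lemma ode_solutionD:
  assumes "ode_solution p u v" "x \<in> {0..pi}"
  shows "(u has_vector_derivative v x) (at x within {0..pi})"
    and "v x = v 0 + integral {0..x} (\<lambda>t. p t * u t)"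
  using assms unfolding ode_solution_def by blast+

lemma ode_solution_continuous:
  assumes p: "p absolutely_integrable_on {0..pi}" and u: "ode_solution p u v"
  shows "continuous_on {0..pi} u" "continuous_on {0..pi} v"
    and "(\<lambda>t. p t * u t) absolutely_integrable_on {0..pi}"
proof -
  show uc: "continuous_on {0..pi} u"
    by (rule continuous_on_vector_derivative[OF ode_solutionD(1)[OF u]])
  show pu: "(\<lambda>t. p t * u t) absolutely_integrable_on {0..pi}"
    by (rule absolutely_integrable_mult_continuous[OF p uc])
  then have "(\<lambda>t. p t * u t) integrable_on {0..pi}"
    by (simp add: absolutely_integrable_on_def)
  then have "continuous_on {0..pi} (\<lambda>x. v 0 + integral {0..x} (\<lambda>t. p t * u t))"
    by (rule continuous_on_add[OF continuous_on_const indefinite_integral_continuous_1])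
  then show "continuous_on {0..pi} v"
    by (rule continuous_on_eq) (rule ode_solutionD(2)[OF u, symmetric])
qed

text \<open>Both products \<open>u * v'\<close> and \<open>u' * v\<close> obey the product rule, and
  the terms \<open>u' * v'\<close> cancel in their difference. Equal coefficients give constancy of
  the Wronskian, coefficients differing by a constant give variation of parameters, and a constant
  \<open>r\<close> gives the Volterra equation.\<close>

lemma Lagrange_identity:
  assumes p: "p absolutely_integrable_on {0..pi}" and r: "r absolutely_integrable_on {0..pi}"
    and u: "ode_solution p u u'" and v: "ode_solution r v v'" and x: "x \<in> {0..pi}"
  shows "u x * v' x - u' x * v x =
    u 0 * v' 0 - u' 0 * v 0 + integral {0..x} (\<lambda>t. (r t - p t) * u t * v t)"
proof -
  note uc = ode_solution_continuous[OF p u] and vc = ode_solution_continuous[OF r v]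
  have i1: "(\<lambda>t. r t * v t * u t + v' t * u' t) integrable_on {0..x}"
    and i2: "(\<lambda>t. p t * u t * v t + u' t * v' t) integrable_on {0..x}"
  proof -
    have "(\<lambda>t. r t * v t * u t) integrable_on {0..pi}" "(\<lambda>t. p t * u t * v t) integrable_on {0..pi}"
      using absolutely_integrable_mult_continuous[OF vc(3) uc(1)]
        absolutely_integrable_mult_continuous[OF uc(3) vc(1)]
      by (auto simp: absolutely_integrable_on_def)
    moreover have "(\<lambda>t. v' t * u' t) integrable_on {0..pi}" "(\<lambda>t. u' t * v' t) integrable_on {0..pi}"
      by (intro integrable_continuous_real continuous_on_mult uc vc)+
    ultimately have "(\<lambda>t. r t * v t * u t + v' t * u' t) integrable_on {0..pi}"
      "(\<lambda>t. p t * u t * v t + u' t * v' t) integrable_on {0..pi}"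
      by (auto intro!: integrable_add)
    from this[THEN integrable_on_subinterval, of 0 x]
    show "(\<lambda>t. r t * v t * u t + v' t * u' t) integrable_on {0..x}"
      "(\<lambda>t. p t * u t * v t + u' t * v' t) integrable_on {0..x}"
      using x by auto
  qed
  have "v' x * u x = v' 0 * u 0 + integral {0..x} (\<lambda>t. r t * v t * u t + v' t * u' t)"
    by (rule product_rule_AC[OF vc(3) ode_solutionD(2)[OF v] ode_solutionD(1)[OF u] uc(2) x])
  moreover have "u' x * v x = u' 0 * v 0 + integral {0..x} (\<lambda>t. p t * u t * v t + u' t * v' t)"
    by (rule product_rule_AC[OF uc(3) ode_solutionD(2)[OF u] ode_solutionD(1)[OF v] vc(2) x])
  moreover have "integral {0..x} (\<lambda>t. r t * v t * u t + v' t * u' t) -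
      integral {0..x} (\<lambda>t. p t * u t * v t + u' t * v' t)
    = integral {0..x} (\<lambda>t. (r t - p t) * u t * v t)"
    unfolding integral_diff[OF i1 i2, symmetric]
    by (rule arg_cong[where f = "integral _"]) (auto simp: algebra_simps)
  ultimately show ?thesis
    by (simp add: algebra_simps)
qed

text \<open>Picard iteration is a contraction for the norm weighted by \<open>exp (- L x)\<close> as soon as
  \<open>L\<close> exceeds the \<open>L\<^sup>1\<close> norm of \<open>p\<close>.\<close>

lemma ode_solution_exists:
  assumes p: "p absolutely_integrable_on {0..pi}"
  shows "\<exists>u v. ode_solution p u v \<and> u 0 = \<alpha> \<and> v 0 = \<beta>"
proof -
  define P where "P = integral {0..pi} (\<lambda>t. norm (p t))"
  have pn: "(\<lambda>t. norm (p t)) integrable_on {0..pi}"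
    using p by (auto simp: absolutely_integrable_on_def)
  have P0: "P \<ge> 0" unfolding P_def by (intro integral_nonneg pn) auto
  \<comment> \<open>Makes the contraction factor \<open>P / L\<close> at most 1/2; the summand 1
    keeps \<open>L\<close> positive when \<open>P\<close> is 0.\<close>
  define L where "L = 2 * P + 1"
  have L0: "L > 0" using P0 by (simp add: L_def)
  \<comment> \<open>The iteration acts on the quotient \<open>u / e\<close>, so that the weighted
    norm becomes the plain supremum norm.\<close>
  define e where "e x = complex_of_real (exp (L * x))" for x
  define V where "V g s = \<beta> + integral {0..s} (\<lambda>t. p t * (e t * g t))" for g :: "real \<Rightarrow> complex" and s
  define A where "A g y = (\<alpha> + integral {0..y} (V g)) / e y" for g :: "real \<Rightarrow> complex" and y
  have ec: "continuous_on S e" for S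
    unfolding e_def by (intro continuous_intros)
  have e0: "e x \<noteq> 0" for x by (simp add: e_def)
  have pg: "(\<lambda>t. p t * (e t * g t)) integrable_on {0..pi}" if "continuous_on {0..pi} g" for g
    using absolutely_integrable_mult_continuous[OF p continuous_on_mult[OF ec that]]
    by (simp add: absolutely_integrable_on_def)
  have Vc: "continuous_on {0..pi} (V g)" if "continuous_on {0..pi} g" for g
    unfolding V_def
    by (rule continuous_on_add[OF continuous_on_const indefinite_integral_continuous_1[OF pg[OF that]]])
  have Ac: "continuous_on {0..pi} (A g)" if "continuous_on {0..pi} g" for g
    unfolding A_def
    by (rule continuous_on_divide[OF continuous_on_add[OF continuous_on_const
        indefinite_integral_continuous_1[OF integrable_continuous_real[OF Vc[OF that]]]] ec]) (simp add: e0)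
  have contr: "norm (A g y - A h y) \<le> 1 / 2 * d"
    if g: "continuous_on {0..pi} g" and h: "continuous_on {0..pi} h" and y: "y \<in> {0..pi}"
      and d: "\<And>t. t \<in> {0..pi} \<Longrightarrow> norm (g t - h t) \<le> d" for g h y d
  proof -
    have d0: "d \<ge> 0" using d[of y] y norm_ge_zero order_trans by blast
    \<comment> \<open>Since \<open>p\<close> is merely integrable, this integration yields only
      \<open>P\<close>; the gain \<open>1 / L\<close> comes from integrating
      \<open>exp (L * s)\<close> in the next one.\<close>
    have Vd: "norm (V g s - V h s) \<le> exp (L * s) * (P * d)" if s: "s \<in> {0..pi}" for s
    proof -
      have sub: "f integrable_on {0..s}" if "f integrable_on {0..pi}" for f :: "real \<Rightarrow> 'z::banach"
        using integrable_on_subinterval[OF that, of 0 s] s by auto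
      have "V g s - V h s = integral {0..s} (\<lambda>t. p t * (e t * g t) - p t * (e t * h t))"
        unfolding V_def using integral_diff[OF sub[OF pg[OF g]] sub[OF pg[OF h]]] by simp
      also have "norm \<dots> \<le> integral {0..s} (\<lambda>t. norm (p t) * (exp (L * s) * d))"
      proof (rule Henstock_Kurzweil_Integration.integral_norm_bound_integral)
        show "(\<lambda>t. p t * (e t * g t) - p t * (e t * h t)) integrable_on {0..s}"
          by (intro integrable_diff sub pg g h)
        show "(\<lambda>t. norm (p t) * (exp (L * s) * d)) integrable_on {0..s}"
          by (intro integrable_on_mult_left sub pn)
        fix t assume t: "t \<in> {0..s}"
        have "p t * (e t * g t) - p t * (e t * h t) = p t * (e t * (g t - h t))"
          by (simp add: algebra_simps)
        then have "norm (p t * (e t * g t) - p t * (e t * h t)) = norm (p t) * (exp (L * t) * norm (g t - h t))"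
          by (simp add: e_def norm_mult)
        also have "\<dots> \<le> norm (p t) * (exp (L * s) * d)"
          using t s L0 d[of t] by (intro mult_left_mono mult_mono) auto
        finally show "norm (p t * (e t * g t) - p t * (e t * h t)) \<le> norm (p t) * (exp (L * s) * d)" .
      qed
      also have "\<dots> = exp (L * s) * (integral {0..s} (\<lambda>t. norm (p t)) * d)"
        by simp
      also have "\<dots> \<le> exp (L * s) * (P * d)"
        unfolding P_def using s d0
        by (intro mult_left_mono mult_right_mono integral_subset_le sub pn) auto
      finally show ?thesis .
    qed
    have "integral {0..y} (V g) - integral {0..y} (V h) = integral {0..y} (\<lambda>s. V g s - V h s)"
      using y by (intro integral_diff[symmetric] integrable_continuous_real)
        (auto intro: continuous_on_subset[OF Vc[OF g]] continuous_on_subset[OF Vc[OF h]])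
    also have "norm \<dots> \<le> integral {0..y} (\<lambda>s. exp (L * s) * (P * d))"
      using y Vd by (intro Henstock_Kurzweil_Integration.integral_norm_bound_integral
          integrable_continuous_real continuous_on_diff continuous_on_mult_right continuous_intros)
        (auto intro: continuous_on_subset[OF Vc[OF g]] continuous_on_subset[OF Vc[OF h]])
    also have "\<dots> = (exp (L * y) / L - exp (L * 0) / L) * (P * d)"
    proof -
      have "((\<lambda>s. exp (L * s)) has_integral exp (L * y) / L - exp (L * 0) / L) {0..y}"
        using y L0 by (intro fundamental_theorem_of_calculus)
          (auto intro!: derivative_eq_intros simp flip: has_real_derivative_iff_has_vector_derivative)
      then show ?thesis by (simp add: integral_unique)
    qed
    also have "\<dots> \<le> exp (L * y) / L * (P * d)"
      using P0 d0 L0 by (intro mult_right_mono) auto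
    finally have *: "norm (integral {0..y} (V g) - integral {0..y} (V h)) \<le> exp (L * y) / L * (P * d)" .
    have "A g y - A h y = (integral {0..y} (V g) - integral {0..y} (V h)) / e y"
      by (simp add: A_def diff_divide_distrib[symmetric])
    then have "norm (A g y - A h y) = norm (integral {0..y} (V g) - integral {0..y} (V h)) / exp (L * y)"
      by (simp add: norm_divide e_def)
    also have "\<dots> \<le> exp (L * y) / L * (P * d) / exp (L * y)"
      by (intro divide_right_mono *) auto
    also have "\<dots> = P / L * d" by simp
    also have "\<dots> \<le> 1 / 2 * d"
      using d0 P0 L0 by (intro mult_right_mono) (auto simp: L_def field_simps)
    finally show ?thesis .
  qed
  \<comment> \<open>The complete space for the fixed point theorem consists of the bounded
    continuous functions on the whole line; \<open>clamp\<close> continues \<open>A g\<close>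
    constantly beyond the end points.\<close>
  have "\<exists>h :: real \<Rightarrow>\<^sub>C complex. \<forall>x. h x = A g (clamp 0 pi x)" if "continuous_on {0..pi} g" for g
  proof -
    have c: "continuous_on (cbox 0 pi) (A g)" using Ac[OF that] by simp
    obtain h :: "real \<Rightarrow>\<^sub>C complex" where "\<And>x. x \<in> cbox 0 pi \<Longrightarrow> h x = A g x" "\<And>x. h x = A g (clamp 0 pi x)"
      using continuous_on_cbox_bcontfunE[OF c] by blast
    then show ?thesis by blast
  qed
  then have "\<forall>g :: real \<Rightarrow>\<^sub>C complex. \<exists>h :: real \<Rightarrow>\<^sub>C complex. \<forall>x. h x = A g (clamp 0 pi x)"
    by simp
  then obtain \<Phi> :: "(real \<Rightarrow>\<^sub>C complex) \<Rightarrow> (real \<Rightarrow>\<^sub>C complex)"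
    where \<Phi>: "\<And>g x. \<Phi> g x = A g (clamp 0 pi x)"
    by metis
  have cl: "clamp 0 pi x \<in> {0..pi}" for x :: real
    using clamp_in_interval[of 0 pi x] by simp
  have "dist (\<Phi> g) (\<Phi> h) \<le> 1 / 2 * dist g h" for g h
  proof (rule dist_bound)
    fix x
    have "norm (A g (clamp 0 pi x) - A h (clamp 0 pi x)) \<le> 1 / 2 * dist g h"
      by (rule contr[OF _ _ cl]) (auto simp: dist_norm[symmetric] intro: dist_bounded)
    then show "dist (\<Phi> g x) (\<Phi> h x) \<le> 1 / 2 * dist g h"
      by (simp add: dist_norm \<Phi>)
  qed
  then have "\<exists>!g. \<Phi> g = g"
    by (intro banach_fix_type[of "1/2"]) auto
  then obtain g where g: "\<Phi> g = g" by blast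
  have gA: "apply_bcontfun g y = A g y" if "y \<in> {0..pi}" for y
    using \<Phi>[of g y] that by (simp add: g)
  define u where "u x = e x * apply_bcontfun g x" for x
  have Vgc: "continuous_on {0..pi} (V g)" by (rule Vc) auto
  have uI: "u x = \<alpha> + integral {0..x} (V g)" if "x \<in> {0..pi}" for x
    using e0[of x] by (simp add: u_def gA[OF that] A_def)
  have "ode_solution p u (V g)"
    unfolding ode_solution_def
  proof (intro conjI ballI)
    fix x assume x: "x \<in> {0..pi}"
    have "((\<lambda>x. \<alpha> + integral {0..x} (V g)) has_vector_derivative V g x) (at x within {0..pi})"
      using has_vector_derivative_add[OF has_vector_derivative_const integral_has_vector_derivative[OF Vgc x]]
      by simp
    then show "(u has_vector_derivative V g x) (at x within {0..pi})"
      by (rule has_vector_derivative_transform[OF x, rotated]) (rule uI)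
    show "V g x = V g 0 + integral {0..x} (\<lambda>t. p t * u t)"
      by (simp add: V_def u_def)
  qed
  moreover have "u 0 = \<alpha>" using uI[of 0] by simp
  moreover have "V g 0 = \<beta>" by (simp add: V_def)
  ultimately show ?thesis by blast
qed

text \<open>Values outside \<open>{0..pi}\<close> are arbitrary.\<close>

definition cauchy_solution :: "(real \<Rightarrow> complex) \<Rightarrow> complex \<Rightarrow> complex \<Rightarrow> (real \<Rightarrow> complex) \<times> (real \<Rightarrow> complex)" where
  "cauchy_solution p \<alpha> \<beta> = (SOME w. ode_solution p (fst w) (snd w) \<and> fst w 0 = \<alpha> \<and> snd w 0 = \<beta>)"

abbreviation "cs p \<equiv> fst (cauchy_solution p 1 0)"
abbreviation "cs' p \<equiv> snd (cauchy_solution p 1 0)"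
abbreviation "sn p \<equiv> fst (cauchy_solution p 0 1)"
abbreviation "sn' p \<equiv> snd (cauchy_solution p 0 1)"

lemma cauchy_solution:
  assumes "p absolutely_integrable_on {0..pi}"
  shows "ode_solution p (fst (cauchy_solution p \<alpha> \<beta>)) (snd (cauchy_solution p \<alpha> \<beta>))"
    and "fst (cauchy_solution p \<alpha> \<beta>) 0 = \<alpha>" "snd (cauchy_solution p \<alpha> \<beta>) 0 = \<beta>"
proof -
  have "\<exists>w. ode_solution p (fst w) (snd w) \<and> fst w 0 = \<alpha> \<and> snd w 0 = \<beta>"
    using ode_solution_exists[OF assms, of \<alpha> \<beta>] by auto
  from someI_ex[OF this]
  show "ode_solution p (fst (cauchy_solution p \<alpha> \<beta>)) (snd (cauchy_solution p \<alpha> \<beta>))"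
    and "fst (cauchy_solution p \<alpha> \<beta>) 0 = \<alpha>" "snd (cauchy_solution p \<alpha> \<beta>) 0 = \<beta>"
    unfolding cauchy_solution_def by blast+
qed

section \<open>Wronskians, linear structure and symmetries of solutions\<close>

lemma Wronskian_cs_sn:
  assumes p: "p absolutely_integrable_on {0..pi}" and x: "x \<in> {0..pi}"
  shows "cs p x * sn' p x - cs' p x * sn p x = 1"
  using Lagrange_identity[OF p p cauchy_solution(1)[OF p, of 1 0] cauchy_solution(1)[OF p, of 0 1] x]
  by (simp add: cauchy_solution(2,3)[OF p])

text \<open>Lagrange's identity against \<open>cs\<close> and \<open>sn\<close> gives two linear
  equations for \<open>u x\<close> and \<open>v x\<close> of determinant 1. The result expresses a
  solution through those at the parameter shifted by \<open>\<zeta>\<close>.\<close>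

lemma variation_of_parameters:
  assumes p: "p absolutely_integrable_on {0..pi}" and u: "ode_solution (\<lambda>t. p t - \<zeta>) u v"
    and x: "x \<in> {0..pi}"
  shows "u x = u 0 * cs p x + v 0 * sn p x +
    \<zeta> * (cs p x * integral {0..x} (\<lambda>t. sn p t * u t) - sn p x * integral {0..x} (\<lambda>t. cs p t * u t))"
proof -
  have p\<zeta>: "(\<lambda>t. p t - \<zeta>) absolutely_integrable_on {0..pi}"
    by (intro set_integral_diff p) (simp add: absolutely_integrable_continuous_real)
  note L = Lagrange_identity[OF p\<zeta> p u cauchy_solution(1)[OF p] x, unfolded cauchy_solution(2,3)[OF p]]
  have 1: "u x * sn' p x - v x * sn p x = u 0 + \<zeta> * integral {0..x} (\<lambda>t. sn p t * u t)"
    using L[of 0 1] by (simp add: mult.assoc mult.commute[of "u _"])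
  have 2: "u x * cs' p x - v x * cs p x = - v 0 + \<zeta> * integral {0..x} (\<lambda>t. cs p t * u t)"
    using L[of 1 0] by (simp add: mult.assoc mult.commute[of "u _"])
  have "u x = cs p x * (u x * sn' p x - v x * sn p x) - sn p x * (u x * cs' p x - v x * cs p x)"
    using arg_cong[OF Wronskian_cs_sn[OF p x], of "\<lambda>w. u x * w"] by (simp add: algebra_simps)
  then show ?thesis
    unfolding 1 2 by (simp add: algebra_simps)
qed

text \<open>The Wronskians of \<open>u\<close> with \<open>cs\<close> and \<open>sn\<close> are
  constant, and they determine \<open>u\<close> and \<open>v\<close> because \<open>cs\<close> and
  \<open>sn\<close> have Wronskian 1. Uniqueness thus comes without a Gronwall estimate.\<close>

lemma ode_solution_unique:
  assumes p: "p absolutely_integrable_on {0..pi}" and u: "ode_solution p u v" and x: "x \<in> {0..pi}"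
  shows "u x = u 0 * cs p x + v 0 * sn p x" "v x = u 0 * cs' p x + v 0 * sn' p x"
proof -
  note L = Lagrange_identity[OF p p u cauchy_solution(1)[OF p] x, unfolded cauchy_solution(2,3)[OF p]]
  have 1: "u x * sn' p x - v x * sn p x = u 0" "u x * cs' p x - v x * cs p x = - v 0"
    using L[of 0 1] L[of 1 0] by simp_all
  have "u x = cs p x * (u x * sn' p x - v x * sn p x) - sn p x * (u x * cs' p x - v x * cs p x)"
    using arg_cong[OF Wronskian_cs_sn[OF p x], of "\<lambda>w. u x * w"] by (simp add: algebra_simps)
  then show "u x = u 0 * cs p x + v 0 * sn p x"
    unfolding 1 by (simp add: algebra_simps)
  have "v x = cs' p x * (u x * sn' p x - v x * sn p x) - sn' p x * (u x * cs' p x - v x * cs p x)"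
    using arg_cong[OF Wronskian_cs_sn[OF p x], of "\<lambda>w. v x * w"] by (simp add: algebra_simps)
  then show "v x = u 0 * cs' p x + v 0 * sn' p x"
    unfolding 1 by (simp add: algebra_simps)
qed

lemma ode_solution_lincomb:
  assumes p: "p absolutely_integrable_on {0..pi}" and u: "ode_solution p u u'" and v: "ode_solution p v v'"
  shows "ode_solution p (\<lambda>x. \<alpha> * u x + \<beta> * v x) (\<lambda>x. \<alpha> * u' x + \<beta> * v' x)"
  unfolding ode_solution_def
proof (intro conjI ballI)
  fix x assume x: "x \<in> {0..pi}"
  show "((\<lambda>x. \<alpha> * u x + \<beta> * v x) has_vector_derivative \<alpha> * u' x + \<beta> * v' x) (at x within {0..pi})"
    by (intro has_vector_derivative_add has_vector_derivative_mult_right ode_solutionD(1)[OF u x]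
        ode_solutionD(1)[OF v x])
  have i: "(\<lambda>t. p t * u t) integrable_on {0..x}" "(\<lambda>t. p t * v t) integrable_on {0..x}"
    using ode_solution_continuous(3)[OF p u] ode_solution_continuous(3)[OF p v] x
    by (auto simp: absolutely_integrable_on_def elim: integrable_on_subinterval)
  have "integral {0..x} (\<lambda>t. p t * (\<alpha> * u t + \<beta> * v t))
      = integral {0..x} (\<lambda>t. \<alpha> * (p t * u t) + \<beta> * (p t * v t))"
    by (rule arg_cong[where f = "integral _"]) (auto simp: algebra_simps)
  also have "\<dots> = \<alpha> * integral {0..x} (\<lambda>t. p t * u t) + \<beta> * integral {0..x} (\<lambda>t. p t * v t)"
    by (subst integral_add) (use i in \<open>auto intro: integrable_on_mult_right\<close>)
  finally show "\<alpha> * u' x + \<beta> * v' x = \<alpha> * u' 0 + \<beta> * v' 0 + integral {0..x} (\<lambda>t. p t * (\<alpha> * u t + \<beta> * v t))"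
    using ode_solutionD(2)[OF u x] ode_solutionD(2)[OF v x] by (simp add: algebra_simps)
qed

lemma ode_solution_cnj:
  assumes "ode_solution p u v" 
  shows "ode_solution (\<lambda>t. cnj (p t)) (\<lambda>t. cnj (u t)) (\<lambda>t. cnj (v t))"
  unfolding ode_solution_def
proof (intro conjI ballI)
  fix x assume x: "x \<in> {0..pi}"
  show "((\<lambda>x. cnj (u x)) has_vector_derivative cnj (v x)) (at x within {0..pi})"
    using ode_solutionD(1)[OF assms x] by (rule has_vector_derivative_cnj)
  have "cnj (integral {0..x} (\<lambda>t. p t * u t)) = integral {0..x} (\<lambda>t. cnj (p t * u t))"
    by (rule integral_cnj)
  then show "cnj (v x) = cnj (v 0) + integral {0..x} (\<lambda>t. cnj (p t) * cnj (u t))"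
    using arg_cong[OF ode_solutionD(2)[OF assms x], of cnj] by simp
qed

text \<open>For a real coefficient the conjugate solves the same initial value problem. This is what
  turns integrals of squares into squared norms.\<close>

lemma cnj_sn_cs:
  assumes p: "p absolutely_integrable_on {0..pi}" and re: "\<And>t. cnj (p t) = p t" and x: "x \<in> {0..pi}"
  shows "cnj (sn p x) = sn p x" "cnj (cs p x) = cs p x"
proof -
  have "ode_solution p (\<lambda>t. cnj (fst (cauchy_solution p \<alpha> \<beta>) t)) (\<lambda>t. cnj (snd (cauchy_solution p \<alpha> \<beta>) t))" for \<alpha> \<beta>
    using ode_solution_cnj[OF cauchy_solution(1)[OF p, of \<alpha> \<beta>]] by (simp only: re)
  from ode_solution_unique(1)[OF p this x, of 0 1] ode_solution_unique(1)[OF p this x, of 1 0]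
  show "cnj (sn p x) = sn p x" "cnj (cs p x) = cs p x"
    by (simp_all add: cauchy_solution(2,3)[OF p])
qed

text \<open>Makes estimates for data prescribed at 0 available for solutions with data prescribed at
  \<open>pi\<close>.\<close>

lemma ode_solution_reflect:
  assumes p: "p absolutely_integrable_on {0..pi}" and u: "ode_solution p u v"
  shows "ode_solution (\<lambda>t. p (pi - t)) (\<lambda>t. u (pi - t)) (\<lambda>t. - v (pi - t))"
  unfolding ode_solution_def
proof (intro conjI ballI)
  fix x :: real assume x: "x \<in> {0..pi}"
  have "((u \<circ> (\<lambda>t. pi - t)) has_vector_derivative (-1) *\<^sub>R v (pi - x)) (at x within {0..pi})"
  proof (rule vector_diff_chain_within)
    show "((\<lambda>t. pi - t) has_vector_derivative - 1) (at x within {0..pi})"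
      by (auto intro!: derivative_eq_intros)
    have "(\<lambda>t. pi - t) ` {0..pi} = {0..pi}"
      by (auto simp: image_iff intro!: bexI[of _ "pi - _"])
    then show "(u has_vector_derivative v (pi - x)) (at (pi - x) within (\<lambda>t. pi - t) ` {0..pi})"
      using ode_solutionD(1)[OF u, of "pi - x"] x by simp
  qed
  then show "((\<lambda>t. u (pi - t)) has_vector_derivative - v (pi - x)) (at x within {0..pi})"
    by (simp add: o_def)
  have "integral {0..x} (\<lambda>t. p (pi - t) * u (pi - t)) = integral {-pi..x - pi} (\<lambda>t. p (- t) * u (- t))"
    using integral_shift_real_ivl[of "-pi" "-pi" "x - pi" "\<lambda>t. p (- t) * u (- t)"] by (simp add: algebra_simps)
  also have "\<dots> = integral {pi - x..pi} (\<lambda>t. p t * u t)"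
    using Henstock_Kurzweil_Integration.integral_reflect_real[of pi "pi - x" "\<lambda>t. p t * u t"] by simp
  also have "\<dots> = v pi - v (pi - x)"
  proof -
    have "integral {0..pi} (\<lambda>t. p t * u t) - integral {0..pi - x} (\<lambda>t. p t * u t)
        = integral {pi - x..pi} (\<lambda>t. p t * u t)"
      using ode_solution_continuous(3)[OF p u] x
      by (intro integral_diff_interval) (auto simp: absolutely_integrable_on_def)
    then show ?thesis
      using ode_solutionD(2)[OF u, of pi] ode_solutionD(2)[OF u, of "pi - x"] x by simp
  qed
  finally show "- v (pi - x) = - v (pi - 0) + integral {0..x} (\<lambda>t. p (pi - t) * u (pi - t))"
    by simp
qed

section \<open>Dependence on the spectral parameter\<close>

lemma absolutely_integrable_minus_const:
  fixes p :: "real \<Rightarrow> complex"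
  assumes "p absolutely_integrable_on {0..pi}"
  shows "(\<lambda>t. p t - \<zeta>) absolutely_integrable_on {0..pi}"
  by (intro set_integral_diff assms) (simp add: absolutely_integrable_continuous_real)

lemma continuous_bounded_Icc:
  fixes f :: "real \<Rightarrow> complex"
  assumes "continuous_on {a..b} f"
  obtains B where "B > 0" "\<And>t. t \<in> {a..b} \<Longrightarrow> norm (f t) \<le> B"
proof -
  have "bounded (f ` {a..b})"
    using assms by (intro compact_imp_bounded compact_continuous_image) auto
  then obtain B where "B > 0" "\<forall>y\<in>f ` {a..b}. norm y \<le> B"
    unfolding bounded_pos by blast
  then show ?thesis using that by blast
qed

text \<open>Variation of parameters based at \<open>w\<close> gives
  \<open>U z - U w = (z - w) * K (U z)\<close>, with an integral operator \<open>K\<close> that does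
  not depend on \<open>z\<close>. Boundedness of \<open>K\<close> makes \<open>U z\<close> converge
  uniformly to \<open>U w\<close>, so the difference quotient \<open>K (U z)\<close> tends to
  \<open>K (U w)\<close>.\<close>

lemma has_field_derivative_cauchy_solution:
  fixes w \<alpha> \<beta> :: complex
  assumes p: "p absolutely_integrable_on {0..pi}" and x: "x \<in> {0..pi}"
  defines "U \<equiv> \<lambda>z. fst (cauchy_solution (\<lambda>t. p t - z) \<alpha> \<beta>)"
    and "c \<equiv> cs (\<lambda>t. p t - w)" and "s \<equiv> sn (\<lambda>t. p t - w)"
  shows "((\<lambda>z. U z x) has_field_derivative
    c x * integral {0..x} (\<lambda>t. s t * U w t) - s x * integral {0..x} (\<lambda>t. c t * U w t)) (at w)"
proof -
  note pz = absolutely_integrable_minus_const[OF p]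
  have cont: "continuous_on {0..pi} (U z)" "continuous_on {0..pi} c" "continuous_on {0..pi} s" for z
    unfolding U_def c_def s_def by (intro ode_solution_continuous(1)[OF pz cauchy_solution(1)[OF pz]])+
  define K where "K f y = c y * integral {0..y} (\<lambda>t. s t * f t) - s y * integral {0..y} (\<lambda>t. c t * f t)"
    for f y
  have int: "(\<lambda>t. s t * f t) integrable_on {0..y}" "(\<lambda>t. c t * f t) integrable_on {0..y}"
    if "continuous_on {0..pi} f" "y \<in> {0..pi}" for f y
    by (intro integrable_continuous_real continuous_on_mult;
        rule continuous_on_subset[where s = "{0..pi}"]; use that cont in auto)+
  have Kdiff: "K f y - K g y = K (\<lambda>t. f t - g t) y"
    if "continuous_on {0..pi} f" "continuous_on {0..pi} g" "y \<in> {0..pi}" for f g y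
    unfolding K_def right_diff_distrib integral_diff[OF int(1)[OF that(1,3)] int(1)[OF that(2,3)]]
      integral_diff[OF int(2)[OF that(1,3)] int(2)[OF that(2,3)]]
    by (simp add: algebra_simps)
  obtain B1 where B1: "B1 > 0" "\<And>t. t \<in> {0..pi} \<Longrightarrow> norm (c t) \<le> B1"
    using continuous_bounded_Icc[OF cont(2)] by blast
  obtain B2 where B2: "B2 > 0" "\<And>t. t \<in> {0..pi} \<Longrightarrow> norm (s t) \<le> B2"
    using continuous_bounded_Icc[OF cont(3)] by blast
  obtain mw where mw: "mw > 0" "\<And>t. t \<in> {0..pi} \<Longrightarrow> norm (U w t) \<le> mw"
    using continuous_bounded_Icc[OF cont(1)] by blast
  \<comment> \<open>Bounds the norm of \<open>K\<close>: each of its two terms contributes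
    \<open>B1 * B2 * pi\<close>.\<close>
  define \<kappa> where "\<kappa> = 2 * B1 * B2 * pi"
  have \<kappa>0: "\<kappa> > 0" using B1 B2 by (simp add: \<kappa>_def)
  have Kbound: "norm (K f y) \<le> \<kappa> * m"
    if f: "continuous_on {0..pi} f" and m: "\<And>t. t \<in> {0..pi} \<Longrightarrow> norm (f t) \<le> m" and y: "y \<in> {0..pi}"
    for f y m
  proof -
    have m0: "m \<ge> 0" using m[OF y] norm_ge_zero order_trans by blast
    have "norm (integral {0..y} (\<lambda>t. s t * f t)) \<le> B2 * m * (y - 0)"
      using y B2 m m0 by (intro integral_bound continuous_on_mult continuous_on_subset[OF f]
          continuous_on_subset[OF cont(3)]) (auto simp: norm_mult intro!: mult_mono)
    also have "\<dots> \<le> B2 * m * pi"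
      using y B2 m0 by (intro mult_left_mono) auto
    finally have 1: "norm (c y * integral {0..y} (\<lambda>t. s t * f t)) \<le> B1 * (B2 * m * pi)"
      using B1 y unfolding norm_mult by (intro mult_mono) auto
    have "norm (integral {0..y} (\<lambda>t. c t * f t)) \<le> B1 * m * (y - 0)"
      using y B1 m m0 by (intro integral_bound continuous_on_mult continuous_on_subset[OF f]
          continuous_on_subset[OF cont(2)]) (auto simp: norm_mult intro!: mult_mono)
    also have "\<dots> \<le> B1 * m * pi"
      using y B1 m0 by (intro mult_left_mono) auto
    finally have 2: "norm (s y * integral {0..y} (\<lambda>t. c t * f t)) \<le> B2 * (B1 * m * pi)"
      using B2 y unfolding norm_mult by (intro mult_mono) auto
    have "norm (K f y) \<le> B1 * (B2 * m * pi) + B2 * (B1 * m * pi)"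
      unfolding K_def by (rule order_trans[OF norm_triangle_ineq4 add_mono[OF 1 2]])
    then show ?thesis by (simp add: \<kappa>_def algebra_simps)
  qed
  have diff: "U z y - U w y = (z - w) * K (U z) y" if y: "y \<in> {0..pi}" for z y
  proof -
    have "ode_solution (\<lambda>t. (p t - w) - (z - w)) (U z) (snd (cauchy_solution (\<lambda>t. p t - z) \<alpha> \<beta>))"
      using cauchy_solution(1)[OF pz[of z], of \<alpha> \<beta>] by (simp add: U_def)
    from variation_of_parameters[OF pz this y]
    have "U z y = \<alpha> * c y + \<beta> * s y + (z - w) * K (U z) y"
      by (simp add: U_def c_def s_def K_def cauchy_solution(2,3)[OF pz])
    moreover have "U w y = \<alpha> * c y + \<beta> * s y"
      using ode_solution_unique(1)[OF pz cauchy_solution(1)[OF pz, of w \<alpha> \<beta>] y]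
      by (simp add: U_def c_def s_def cauchy_solution(2,3)[OF pz])
    ultimately show ?thesis by simp
  qed
  \<comment> \<open>Near \<open>w\<close> half of the maximum \<open>m\<close> of
    \<open>norm (U z t)\<close> is absorbed, whence \<open>m \<le> 2 * mw\<close>; a second use of
    the bound on \<open>K\<close> then gives the linear error.\<close>
  have close: "norm ((U z x - U w x) / (z - w) - K (U w) x) \<le> 2 * \<kappa>\<^sup>2 * mw * norm (z - w)"
    if z: "z \<noteq> w" "norm (z - w) * \<kappa> \<le> 1/2" for z
  proof -
    have "continuous_on {0..pi} (\<lambda>t. norm (U z t))"
      by (intro continuous_on_norm cont)
    then obtain y0 where y0: "y0 \<in> {0..pi}" "\<And>t. t \<in> {0..pi} \<Longrightarrow> norm (U z t) \<le> norm (U z y0)"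
      using continuous_attains_sup[of "{0..pi}" "\<lambda>t. norm (U z t)"] pi_ge_zero by auto
    define m where "m = norm (U z y0)"
    have Kz: "norm (K (U z) y) \<le> \<kappa> * m" if "y \<in> {0..pi}" for y
      using y0 that cont by (intro Kbound) (auto simp: m_def)
    have "m \<le> norm (U w y0) + norm (U z y0 - U w y0)"
      unfolding m_def by (metis add.commute diff_add_cancel norm_triangle_ineq)
    also have "\<dots> \<le> mw + norm (z - w) * (\<kappa> * m)"
      unfolding diff[OF y0(1)] norm_mult using mw y0 Kz by (intro add_mono mult_left_mono) auto
    also have "norm (z - w) * (\<kappa> * m) \<le> 1/2 * m"
      unfolding mult.assoc[symmetric] using z by (intro mult_right_mono) (auto simp: m_def)
    finally have m: "m \<le> 2 * mw" by simp
    have d: "norm (U z t - U w t) \<le> norm (z - w) * (\<kappa> * (2 * mw))" if "t \<in> {0..pi}" for t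
      unfolding diff[OF that] norm_mult
      using order_trans[OF Kz[OF that] mult_left_mono[OF m]] \<kappa>0 by (intro mult_left_mono) auto
    have "(U z x - U w x) / (z - w) - K (U w) x = K (\<lambda>t. U z t - U w t) x"
      using diff[OF x] z Kdiff[OF cont(1) cont(1) x] by simp
    also have "norm \<dots> \<le> \<kappa> * (norm (z - w) * (\<kappa> * (2 * mw)))"
      using d x cont by (intro Kbound continuous_on_diff) auto
    finally show ?thesis by (simp add: power2_eq_square algebra_simps)
  qed
  have "((\<lambda>z. (U z x - U w x) / (z - w)) \<longlongrightarrow> K (U w) x) (at w)"
  proof (rule LIM_zero_cancel, rule Lim_null_comparison)
    have "\<forall>\<^sub>F z in at w. dist z w < 1 / (2 * \<kappa>)"
      using \<kappa>0 by (auto simp: eventually_at intro!: exI[of _ "1 / (2 * \<kappa>)"])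
    moreover have "\<forall>\<^sub>F z in at w. z \<noteq> w"
      by (simp add: eventually_at_filter)
    ultimately show "\<forall>\<^sub>F z in at w. norm ((U z x - U w x) / (z - w) - K (U w) x)
        \<le> 2 * \<kappa>\<^sup>2 * mw * norm (z - w)"
    proof eventually_elim
      case (elim z)
      then have "norm (z - w) * \<kappa> \<le> 1/2"
        using \<kappa>0 by (simp add: dist_norm field_simps)
      with elim show ?case using close by blast
    qed
    have "((\<lambda>z. 2 * \<kappa>\<^sup>2 * mw * norm (z - w)) \<longlongrightarrow> 2 * \<kappa>\<^sup>2 * mw * norm (w - w)) (at w)"
      by (intro tendsto_intros)
    then show "((\<lambda>z. 2 * \<kappa>\<^sup>2 * mw * norm (z - w)) \<longlongrightarrow> 0) (at w)" by simp
  qed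
  then show ?thesis
    by (simp add: has_field_derivative_iff K_def)
qed

lemma holomorphic_cauchy_solution:
  assumes "p absolutely_integrable_on {0..pi}" "x \<in> {0..pi}"
  shows "(\<lambda>z. fst (cauchy_solution (\<lambda>t. p t - z) \<alpha> \<beta>) x) holomorphic_on UNIV"
  using has_field_derivative_cauchy_solution[OF assms] holomorphic_on_open[OF open_UNIV] by blast

section \<open>Volterra equation and asymptotics for large spectral parameter\<close>

lemma has_vector_derivative_sin_cos:
  fixes k :: complex
  assumes "k \<noteq> 0"
  shows "((\<lambda>t. sin (k * (of_real x - of_real t)) / k) has_vector_derivative
       - cos (k * (of_real x - of_real t))) (at t within S)"
    and "((\<lambda>t. - cos (k * (of_real x - of_real t))) has_vector_derivative
       - k\<^sup>2 * (sin (k * (of_real x - of_real t)) / k)) (at t within S)"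
proof -
  have "((\<lambda>z. sin (k * (of_real x - z)) / k) has_field_derivative - cos (k * (of_real x - of_real t))) (at (of_real t))"
    using assms by (auto intro!: derivative_eq_intros)
  from has_vector_derivative_real_field[OF this]
  show "((\<lambda>t. sin (k * (of_real x - of_real t)) / k) has_vector_derivative
       - cos (k * (of_real x - of_real t))) (at t within S)" .
  have "((\<lambda>z. - cos (k * (of_real x - z))) has_field_derivative
      - k\<^sup>2 * (sin (k * (of_real x - of_real t)) / k)) (at (of_real t))"
    using assms by (auto intro!: derivative_eq_intros simp: power2_eq_square)
  from has_vector_derivative_real_field[OF this]
  show "((\<lambda>t. - cos (k * (of_real x - of_real t))) has_vector_derivative
       - k\<^sup>2 * (sin (k * (of_real x - of_real t)) / k)) (at t within S)" .
qed

text \<open>Lagrange's identity against the free solution \<open>sin (k * (x - t)) / k\<close>,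
  regarded as a function of \<open>t\<close>: at \<open>t = x\<close> it vanishes and has derivative
  -1, so the boundary term there is just \<open>- u x\<close>.\<close>

lemma Volterra_equation:
  fixes k :: complex
  assumes p: "p absolutely_integrable_on {0..pi}" and k: "k \<noteq> 0"
    and u: "ode_solution (\<lambda>t. p t - k\<^sup>2) u v" and x: "x \<in> {0..pi}"
  shows "u x = u 0 * cos (k * of_real x) + v 0 * (sin (k * of_real x) / k) +
    integral {0..x} (\<lambda>t. p t * u t * (sin (k * (of_real x - of_real t)) / k))"
proof -
  let ?V = "\<lambda>t. sin (k * (of_real x - of_real t)) / k"
  let ?V' = "\<lambda>t. - cos (k * (of_real x - of_real t))"
  have V: "ode_solution (\<lambda>t. - k\<^sup>2) ?V ?V'"
    unfolding ode_solution_def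
  proof (intro conjI ballI)
    fix y assume "y \<in> {0..pi}"
    have I: "((\<lambda>t. - k\<^sup>2 * ?V t) has_integral ?V' y - ?V' 0) {0..y}"
      using \<open>y \<in> {0..pi}\<close> by (intro fundamental_theorem_of_calculus has_vector_derivative_sin_cos(2) k) auto
    show "?V' y = ?V' 0 + integral {0..y} (\<lambda>t. - k\<^sup>2 * ?V t)"
      unfolding integral_unique[OF I] by simp
  qed (rule has_vector_derivative_sin_cos(1)[OF k])
  have "(\<lambda>t. - k\<^sup>2) absolutely_integrable_on {0..pi}"
    by (intro absolutely_integrable_continuous_real continuous_intros)
  from Lagrange_identity[OF absolutely_integrable_minus_const[OF p] this u V x]
  have "- u x = - (u 0 * cos (k * of_real x)) - v 0 * (sin (k * of_real x) / k) +
    integral {0..x} (\<lambda>t. - (p t * u t * ?V t))"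
    by simp
  then show ?thesis
    by (simp add: algebra_simps minus_equation_iff[of "u x"])
qed

text \<open>Let \<open>m\<close> be the maximum of
  \<open>norm (u t) / exp (\<bar>Im k\<bar> * t)\<close>. The growth of the sine kernel matches this
  weight exactly, so the Volterra equation gives \<open>m \<le> M + m * P / norm k\<close>, and
  \<open>2 * P \<le> norm k\<close> absorbs the last term. Inserting \<open>m \<le> 2 * M\<close>
  into the integral once more yields the error bound.\<close>

lemma solution_asymptotics:
  fixes k :: complex
  assumes p: "p absolutely_integrable_on {0..pi}" and k: "k \<noteq> 0"
    and u: "ode_solution (\<lambda>t. p t - k\<^sup>2) u v"
    and P: "integral {0..pi} (\<lambda>t. norm (p t)) \<le> P" "2 * P \<le> norm k"
    and M: "\<And>x. x \<in> {0..pi} \<Longrightarrow>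
      norm (u 0 * cos (k * of_real x) + v 0 * (sin (k * of_real x) / k)) \<le> M * exp (\<bar>Im k\<bar> * x)"
    and x: "x \<in> {0..pi}"
  shows "norm (u x) \<le> 2 * M * exp (\<bar>Im k\<bar> * x)"
    and "norm (u x - (u 0 * cos (k * of_real x) + v 0 * (sin (k * of_real x) / k)))
      \<le> 2 * M * P / norm k * exp (\<bar>Im k\<bar> * x)"
proof -
  define \<kappa> where "\<kappa> = \<bar>Im k\<bar>"
  let ?F = "\<lambda>x. u 0 * cos (k * of_real x) + v 0 * (sin (k * of_real x) / k)"
  note uc = ode_solution_continuous[OF absolutely_integrable_minus_const[OF p] u]
  have pn: "(\<lambda>t. norm (p t)) integrable_on {0..pi}"
    using p by (simp add: absolutely_integrable_on_def)
  have "continuous_on {0..pi} (\<lambda>t. norm (u t) / exp (\<kappa> * t))"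
    by (intro continuous_intros uc) auto
  then obtain y0 where y0: "y0 \<in> {0..pi}"
      "\<And>t. t \<in> {0..pi} \<Longrightarrow> norm (u t) / exp (\<kappa> * t) \<le> norm (u y0) / exp (\<kappa> * y0)"
    using continuous_attains_sup[of "{0..pi}" "\<lambda>t. norm (u t) / exp (\<kappa> * t)"] pi_ge_zero by auto
  define m where "m = norm (u y0) / exp (\<kappa> * y0)"
  have m0: "m \<ge> 0" by (simp add: m_def)
  have um: "norm (u t) \<le> m * exp (\<kappa> * t)" if "t \<in> {0..pi}" for t
    using y0(2)[OF that] by (simp add: m_def[symmetric] divide_le_eq)
  have k0: "norm k > 0" using k by simp
  have diff: "norm (u y - ?F y) \<le> m * P / norm k * exp (\<kappa> * y)" if y: "y \<in> {0..pi}" for y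
  proof -
    have sub: "f integrable_on {0..y}" if "f integrable_on {0..pi}" for f :: "real \<Rightarrow> 'z::banach"
      using integrable_on_subinterval[OF that, of 0 y] y by auto
    have "(\<lambda>t. p t * u t * (sin (k * (of_real y - of_real t)) / k)) absolutely_integrable_on {0..pi}"
      by (intro absolutely_integrable_mult_continuous p uc continuous_intros) (use k in auto)
    then have int: "(\<lambda>t. p t * u t * (sin (k * (of_real y - of_real t)) / k)) integrable_on {0..y}"
      by (intro sub) (simp add: absolutely_integrable_on_def)
    have "u y - ?F y = integral {0..y} (\<lambda>t. p t * u t * (sin (k * (of_real y - of_real t)) / k))"
      using Volterra_equation[OF p k u y] by simp
    also have "norm \<dots> \<le> integral {0..y} (\<lambda>t. norm (p t) * (m * exp (\<kappa> * y) / norm k))"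
    proof (rule Henstock_Kurzweil_Integration.integral_norm_bound_integral[OF int])
      show "(\<lambda>t. norm (p t) * (m * exp (\<kappa> * y) / norm k)) integrable_on {0..y}"
        by (intro integrable_on_mult_left sub pn)
      fix t assume t: "t \<in> {0..y}"
      have "norm (sin (k * (of_real y - of_real t))) \<le> exp \<bar>Im (k * (of_real y - of_real t))\<bar>"
        using cmod_sin_le_exp[of 1 "k * (of_real y - of_real t)"] by simp
      also have "\<bar>Im (k * (of_real y - of_real t))\<bar> = \<kappa> * (y - t)"
        using t by (simp add: \<kappa>_def abs_mult flip: of_real_diff)
      finally have s: "norm (sin (k * (of_real y - of_real t))) \<le> exp (\<kappa> * (y - t))" .
      have "norm (p t * u t * (sin (k * (of_real y - of_real t)) / k))
          = norm (p t) * (norm (u t) * norm (sin (k * (of_real y - of_real t))) / norm k)"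
        by (simp add: norm_mult norm_divide)
      also have "\<dots> \<le> norm (p t) * ((m * exp (\<kappa> * t)) * exp (\<kappa> * (y - t)) / norm k)"
        using t y um[of t] s m0 by (intro mult_left_mono divide_right_mono mult_mono) auto
      also have "\<dots> = norm (p t) * (m * exp (\<kappa> * y) / norm k)"
        by (simp add: exp_add[symmetric] algebra_simps)
      finally show "norm (p t * u t * (sin (k * (of_real y - of_real t)) / k))
          \<le> norm (p t) * (m * exp (\<kappa> * y) / norm k)" .
    qed
    also have "\<dots> = integral {0..y} (\<lambda>t. norm (p t)) * (m * exp (\<kappa> * y) / norm k)"
      by simp
    also have "\<dots> \<le> P * (m * exp (\<kappa> * y) / norm k)"
      using y m0 by (intro mult_right_mono order_trans[OF integral_subset_le P(1)] sub pn) auto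
    finally show ?thesis by (simp add: algebra_simps)
  qed
  have "norm (u y0) \<le> norm (?F y0) + norm (u y0 - ?F y0)"
    by (metis add.commute diff_add_cancel norm_triangle_ineq)
  also have "\<dots> \<le> M * exp (\<kappa> * y0) + m * P / norm k * exp (\<kappa> * y0)"
    using M[OF y0(1)] diff[OF y0(1)] by (intro add_mono) (auto simp: \<kappa>_def)
  finally have "m \<le> M + m * P / norm k"
    by (simp add: m_def divide_le_eq distrib_right)
  also have "m * P / norm k \<le> m * (1/2)"
  proof -
    have "P / norm k \<le> 1/2" using P(2) k0 by (simp add: divide_le_eq)
    from mult_left_mono[OF this m0] show ?thesis by simp
  qed
  finally have m: "m \<le> 2 * M" by simp
  then have "m * exp (\<kappa> * x) \<le> 2 * M * exp (\<kappa> * x)"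
    by (intro mult_right_mono) auto
  from order_trans[OF um[OF x] this] show "norm (u x) \<le> 2 * M * exp (\<bar>Im k\<bar> * x)"
    by (simp add: \<kappa>_def)
  have P0: "P \<ge> 0"
    using integral_nonneg[OF pn] P(1) by simp
  then have "m * P / norm k * exp (\<kappa> * x) \<le> 2 * M * P / norm k * exp (\<kappa> * x)"
    using m by (intro mult_right_mono divide_right_mono) auto
  from order_trans[OF diff[OF x] this] show "norm (u x - ?F x) \<le> 2 * M * P / norm k * exp (\<bar>Im k\<bar> * x)"
    by (simp add: \<kappa>_def)
qed

section \<open>Estimates on large circles\<close>

text \<open>Close to the real axis \<open>\<bar>x\<bar>\<close> falls short of
  \<open>N + 1/4\<close> by some \<open>\<delta> \<le> 1/10\<close>, because
  \<open>\<delta> * (R + \<bar>x\<bar>) = y\<^sup>2\<close>. The quarter shift turns the cosine into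
  \<open>sin (2 * pi * \<delta>)\<close>, which is at most 0.64.\<close>

lemma cos_small_on_circle:
  fixes x y :: real
  assumes xy: "x\<^sup>2 + y\<^sup>2 = (real N + 1/4)\<^sup>2" and y: "\<bar>y\<bar> \<le> 1" and N: "N \<ge> 10"
  shows "\<bar>cos (2 * pi * x)\<bar> \<le> 3/4"
proof -
  define R where "R = real N + 1/4"
  have R: "R \<ge> 10" using N by (simp add: R_def)
  define \<delta> where "\<delta> = R - \<bar>x\<bar>"
  have y2: "y\<^sup>2 \<le> 1" using y by (simp add: abs_square_le_1)
  have prod: "\<delta> * (R + \<bar>x\<bar>) = y\<^sup>2"
  proof -
    have "\<delta> * (R + \<bar>x\<bar>) = R\<^sup>2 - x\<^sup>2"
      by (simp add: \<delta>_def algebra_simps power2_eq_square)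
    then show ?thesis using xy by (simp add: R_def)
  qed
  have \<delta>0: "\<delta> \<ge> 0"
  proof (rule ccontr)
    assume "\<not> \<delta> \<ge> 0"
    then have "\<delta> * (R + \<bar>x\<bar>) < 0" using R by (intro mult_neg_pos) auto
    then show False using prod by simp
  qed
  have "\<delta> * 10 \<le> \<delta> * (R + \<bar>x\<bar>)"
    using \<delta>0 R by (intro mult_left_mono) auto
  then have \<delta>1: "\<delta> \<le> 1/10" using prod y2 by simp
  have "cos (2 * pi * x) = cos (2 * pi * \<bar>x\<bar>)"
    by (cases "x \<ge> 0") (auto simp: abs_if)
  also have "2 * pi * \<bar>x\<bar> = (pi / 2 - 2 * pi * \<delta>) + 2 * real N * pi"
    by (simp add: \<delta>_def R_def algebra_simps)
  also have "cos \<dots> = sin (2 * pi * \<delta>)"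
    by (simp only: cos_add cos_2npi sin_2npi) (simp add: cos_diff)
  finally have "\<bar>cos (2 * pi * x)\<bar> \<le> \<bar>2 * pi * \<delta>\<bar>"
    using abs_sin_x_le_abs_x[of "2 * pi * \<delta>"] by simp
  also have "\<dots> = 2 * pi * \<delta>" using \<delta>0 by simp
  also have "\<dots> \<le> 2 * 3.2 * (1/10)"
    using \<delta>0 \<delta>1 pi_approx by (intro mult_mono) auto
  finally show ?thesis by simp
qed

text \<open>The squared moduli of sine and cosine are \<open>(E + inverse E - 2 * C) / 4\<close> and
  \<open>(E + inverse E + 2 * C) / 4\<close>, so one bound on \<open>\<bar>C\<bar>\<close> serves
  both.\<close>

lemma sin_cos_large_on_circle:
  fixes k :: complex
  assumes k: "norm k = real N + 1/4" and N: "N \<ge> 10"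
  shows "exp (\<bar>Im k\<bar> * pi) / 4 \<le> norm (sin (k * of_real pi))"
    and "exp (\<bar>Im k\<bar> * pi) / 4 \<le> norm (cos (k * of_real pi))"
proof -
  define C where "C = cos (2 * pi * Re k)"
  define E where "E = exp (2 * pi * Im k)"
  have E0: "E > 0" by (simp add: E_def)
  have s: "norm (sin (k * of_real pi)) ^ 2 = (E + inverse E - 2 * C) / 4"
    unfolding norm_sin_squared by (simp add: E_def C_def mult_ac)
  have c: "norm (cos (k * of_real pi)) ^ 2 = (E + inverse E + 2 * C) / 4"
  proof -
    have C: "C = 2 * cos (pi * Re k) ^ 2 - 1"
      using cos_double_cos[of "pi * Re k"] by (simp add: C_def mult_ac)
    have E: "E = exp (pi * Im k) ^ 2"
      by (simp add: E_def exp_double[symmetric] mult_ac)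
    show ?thesis
      unfolding norm_cos_squared C E by (simp add: power2_eq_square field_simps)
  qed
  have E2: "exp (\<bar>Im k\<bar> * pi) ^ 2 \<le> E + inverse E"
  proof -
    have "exp (\<bar>Im k\<bar> * pi) ^ 2 = exp (2 * pi * \<bar>Im k\<bar>)"
      by (simp add: exp_double[symmetric] mult_ac)
    also have "\<dots> = E \<or> \<dots> = inverse E"
      by (auto simp: E_def abs_if exp_minus[symmetric])
    finally show ?thesis using E0 by auto
  qed
  \<comment> \<open>Equivalent to \<open>8 * \<bar>C\<bar> \<le> 3 * (E + inverse E)\<close>. Near
    the real axis the bound 3/4 on \<open>\<bar>C\<bar>\<close> is exactly what
    \<open>E + inverse E \<ge> 2\<close> can balance; elsewhere \<open>E + inverse E\<close> exceeds
    7.\<close>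
  have main: "(E + inverse E) / 16 \<le> (E + inverse E - 2 * \<bar>C\<bar>) / 4"
  proof (cases "\<bar>Im k\<bar> \<le> 1")
    case True
    have "\<bar>C\<bar> \<le> 3/4"
      unfolding C_def by (rule cos_small_on_circle[OF _ True N]) (use k in \<open>simp add: cmod_power2[symmetric]\<close>)
    moreover have "E + inverse E \<ge> 2"
      using E0 zero_le_square[of "E - 1"] by (simp add: field_simps power2_eq_square)
    ultimately show ?thesis by simp
  next
    case False
    have "1 + 2 * pi \<le> exp (2 * pi)" by (rule exp_ge_add_one_self)
    also have "\<dots> \<le> exp (2 * pi * \<bar>Im k\<bar>)" using False by simp
    also have "\<dots> = exp (\<bar>Im k\<bar> * pi) ^ 2"
      by (simp add: exp_double[symmetric] mult_ac)
    finally have "1 + 2 * pi \<le> E + inverse E" using E2 by simp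
    moreover have "\<bar>C\<bar> \<le> 1" by (simp add: C_def)
    ultimately show ?thesis using pi_gt3 by simp
  qed
  have *: "exp (\<bar>Im k\<bar> * pi) / 4 \<le> t" if "t \<ge> 0" "(E + inverse E - 2 * \<bar>C\<bar>) / 4 \<le> t\<^sup>2" for t
  proof (rule power2_le_imp_le)
    show "(exp (\<bar>Im k\<bar> * pi) / 4)\<^sup>2 \<le> t\<^sup>2"
      using that(2) main E2 by (simp add: power_divide)
  qed (use that in auto)
  show "exp (\<bar>Im k\<bar> * pi) / 4 \<le> norm (sin (k * of_real pi))"
    by (rule *) (auto simp: s)
  show "exp (\<bar>Im k\<bar> * pi) / 4 \<le> norm (cos (k * of_real pi))"
    by (rule *) (auto simp: c)
qed

text \<open>The free solution has \<open>M = 1\<close> for \<open>cs\<close> and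
  \<open>M = 1 / norm k\<close> for \<open>sn\<close>, which accounts for the additional power of
  \<open>norm k\<close> in the bounds for \<open>sn\<close>.\<close>

lemma cs_sn_asymptotics:
  fixes k :: complex
  assumes p: "p absolutely_integrable_on {0..pi}" and k: "k \<noteq> 0"
    and P: "integral {0..pi} (\<lambda>t. norm (p t)) \<le> P" "2 * P \<le> norm k" and x: "x \<in> {0..pi}"
  shows "norm (cs (\<lambda>t. p t - k\<^sup>2) x) \<le> 2 * exp (\<bar>Im k\<bar> * x)"
    and "norm (sn (\<lambda>t. p t - k\<^sup>2) x) \<le> 2 / norm k * exp (\<bar>Im k\<bar> * x)"
    and "norm (cs (\<lambda>t. p t - k\<^sup>2) x - cos (k * of_real x)) \<le> 2 * P / norm k * exp (\<bar>Im k\<bar> * x)"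
    and "norm (sn (\<lambda>t. p t - k\<^sup>2) x - sin (k * of_real x) / k) \<le> 2 * P / (norm k)\<^sup>2 * exp (\<bar>Im k\<bar> * x)"
proof -
  note pk = absolutely_integrable_minus_const[OF p, of "k\<^sup>2"]
  have Im: "\<bar>Im (k * of_real y)\<bar> = \<bar>Im k\<bar> * y" if "y \<in> {0..pi}" for y
    using that by (simp add: abs_mult)
  have c: "norm (cos (k * of_real y)) \<le> exp (\<bar>Im k\<bar> * y)" if "y \<in> {0..pi}" for y
    using cmod_cos_le_exp[of 1 "k * of_real y"] Im[OF that] by simp
  have s: "norm (sin (k * of_real y)) \<le> exp (\<bar>Im k\<bar> * y)" if "y \<in> {0..pi}" for y
    using cmod_sin_le_exp[of 1 "k * of_real y"] Im[OF that] by simp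
  note A = solution_asymptotics[OF p k cauchy_solution(1)[OF pk] P _ x, unfolded cauchy_solution(2,3)[OF pk]]
  show "norm (cs (\<lambda>t. p t - k\<^sup>2) x) \<le> 2 * exp (\<bar>Im k\<bar> * x)"
    using A(1)[of 1 0 1] c by simp
  show "norm (cs (\<lambda>t. p t - k\<^sup>2) x - cos (k * of_real x)) \<le> 2 * P / norm k * exp (\<bar>Im k\<bar> * x)"
    using A(2)[of 1 0 1] c by simp
  have s': "norm (0 * cos (k * of_real y) + 1 * (sin (k * of_real y) / k)) \<le> 1 / norm k * exp (\<bar>Im k\<bar> * y)"
    if "y \<in> {0..pi}" for y
    using divide_right_mono[OF s[OF that], of "norm k"] by (simp add: norm_divide)
  show "norm (sn (\<lambda>t. p t - k\<^sup>2) x) \<le> 2 / norm k * exp (\<bar>Im k\<bar> * x)"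
    using A(1)[OF s'] by simp
  show "norm (sn (\<lambda>t. p t - k\<^sup>2) x - sin (k * of_real x) / k) \<le> 2 * P / (norm k)\<^sup>2 * exp (\<bar>Im k\<bar> * x)"
    using A(2)[OF s'] by (simp add: power2_eq_square)
qed

text \<open>By the Wronskian this combination is the solution that vanishes at \<open>pi\<close>
  with derivative -1 there. Reflected, it has the Cauchy data of a sine solution at 0, which gives
  decay towards \<open>pi\<close>.\<close>

lemma right_solution_bound:
  fixes k :: complex
  assumes p: "p absolutely_integrable_on {0..pi}" and k: "k \<noteq> 0"
    and P: "integral {0..pi} (\<lambda>t. norm (p t)) \<le> P" "2 * P \<le> norm k" and x: "x \<in> {0..pi}"
  defines "c \<equiv> cs (\<lambda>t. p t - k\<^sup>2)" and "s \<equiv> sn (\<lambda>t. p t - k\<^sup>2)"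
  shows "norm (s pi * c x - c pi * s x) \<le> 2 / norm k * exp (\<bar>Im k\<bar> * (pi - x))"
proof -
  note pk = absolutely_integrable_minus_const[OF p, of "k\<^sup>2"]
  let ?w = "\<lambda>x. s pi * c x + (- c pi) * s x"
  let ?w' = "\<lambda>x. s pi * cs' (\<lambda>t. p t - k\<^sup>2) x + (- c pi) * sn' (\<lambda>t. p t - k\<^sup>2) x"
  have w: "ode_solution (\<lambda>t. p t - k\<^sup>2) ?w ?w'"
    unfolding c_def s_def by (intro ode_solution_lincomb pk cauchy_solution(1))
  from ode_solution_reflect[OF pk w]
  have v: "ode_solution (\<lambda>t. p (pi - t) - k\<^sup>2) (\<lambda>t. ?w (pi - t)) (\<lambda>t. - ?w' (pi - t))" .
  have refl: "((\<lambda>t. f (pi - t)) has_integral i) {0..pi}" if "(f has_integral i) {0..pi}"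
    for f :: "real \<Rightarrow> 'z::real_normed_vector" and i
  proof -
    have "((\<lambda>t. f (- t)) has_integral i) {- pi..0}"
      using Henstock_Kurzweil_Integration.has_integral_reflect_real[of f i pi 0] that by simp
    from has_integral_shift_real_ivl[OF this, of "- pi"] show ?thesis by simp
  qed
  have np: "(\<lambda>t. norm (p t)) integrable_on {0..pi}" and ip: "p integrable_on {0..pi}"
    using p by (auto simp: absolutely_integrable_on_def)
  have p': "(\<lambda>t. p (pi - t)) absolutely_integrable_on {0..pi}"
    unfolding absolutely_integrable_on_def
    using refl[OF integrable_integral[OF np]] refl[OF integrable_integral[OF ip]] by blast
  have P': "integral {0..pi} (\<lambda>t. norm (p (pi - t))) \<le> P"
    using integral_unique[OF refl[OF integrable_integral[OF np]]] P(1) by simp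
  have v0: "- ?w' (pi - 0) = 1"
    using Wronskian_cs_sn[OF pk, of pi] by (simp add: c_def s_def algebra_simps)
  have bd: "norm (?w (pi - 0) * cos (k * of_real y) + - ?w' (pi - 0) * (sin (k * of_real y) / k))
      \<le> 1 / norm k * exp (\<bar>Im k\<bar> * y)" if y: "y \<in> {0..pi}" for y
  proof -
    have "norm (sin (k * of_real y)) \<le> exp (\<bar>Im k\<bar> * y)"
      using cmod_sin_le_exp[of 1 "k * of_real y"] y by (simp add: abs_mult)
    from divide_right_mono[OF this, of "norm k"] show ?thesis
      unfolding v0 by (simp add: norm_divide mult.commute)
  qed
  have x': "pi - x \<in> {0..pi}" using x by auto
  have "norm (?w (pi - (pi - x))) \<le> 2 * (1 / norm k) * exp (\<bar>Im k\<bar> * (pi - x))"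
    by (rule solution_asymptotics(1)[OF p' k v P' P(2) bd x'])
  then show ?thesis by simp
qed

text \<open>With \<open>e = exp (\<bar>Im k\<bar> * pi)\<close>, the cosine has modulus at least
  \<open>e / 4\<close>, and both \<open>cs pi\<close> lie within \<open>2 * P / norm k * e\<close>
  of it. The condition \<open>16 * P \<le> norm k\<close> makes this error at most
  \<open>e / 8\<close>, which leaves the lower bound \<open>e / 8\<close>; twice the error divided
  by that bound produces the constant 32. For \<open>sn\<close> everything is scaled by
  \<open>1 / norm k\<close>.\<close>

lemma circle_estimates:
  fixes k :: complex
  assumes p: "p absolutely_integrable_on {0..pi}" "r absolutely_integrable_on {0..pi}"
    and P: "integral {0..pi} (\<lambda>t. norm (p t)) \<le> P" "integral {0..pi} (\<lambda>t. norm (r t)) \<le> P"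
    and k: "norm k = real N + 1/4" "N \<ge> 10" "16 * P \<le> norm k"
  shows "exp (\<bar>Im k\<bar> * pi) / 8 \<le> norm (cs (\<lambda>t. p t - k\<^sup>2) pi)"
    and "exp (\<bar>Im k\<bar> * pi) / (8 * norm k) \<le> norm (sn (\<lambda>t. p t - k\<^sup>2) pi)"
    and "norm (cs (\<lambda>t. r t - k\<^sup>2) pi - cs (\<lambda>t. p t - k\<^sup>2) pi) \<le> 32 * P / norm k * norm (cs (\<lambda>t. p t - k\<^sup>2) pi)"
    and "norm (sn (\<lambda>t. r t - k\<^sup>2) pi - sn (\<lambda>t. p t - k\<^sup>2) pi) \<le> 32 * P / norm k * norm (sn (\<lambda>t. p t - k\<^sup>2) pi)"
proof -
  define e where "e = exp (\<bar>Im k\<bar> * pi)"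
  have e0: "e > 0" by (simp add: e_def)
  have k0: "k \<noteq> 0" "norm k > 0" using k by auto
  have "(\<lambda>t. norm (p t)) integrable_on {0..pi}"
    using p by (simp add: absolutely_integrable_on_def)
  then have P0: "P \<ge> 0"
    using integral_nonneg[of "\<lambda>t. norm (p t)" "{0..pi}"] P(1) by simp
  then have k2: "2 * P \<le> norm k" using k by simp
  have pi: "pi \<in> {0..pi}" by simp
  note Ap = cs_sn_asymptotics(3,4)[OF p(1) k0(1) P(1) k2 pi, folded e_def]
  note Ar = cs_sn_asymptotics(3,4)[OF p(2) k0(1) P(2) k2 pi, folded e_def]
  note large = sin_cos_large_on_circle[OF k(1,2), folded e_def]
  have small: "2 * P / norm k \<le> 1/8" using k(3) k0 by (simp add: divide_le_eq)
  have tri: "norm b \<le> norm a + norm (a - b)" for a b :: complex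
    using norm_triangle_sub[of b a] by (simp add: norm_minus_commute)
  have c: "e / 8 \<le> norm (cs (\<lambda>t. p t - k\<^sup>2) pi)"
  proof -
    have "e / 4 \<le> norm (cs (\<lambda>t. p t - k\<^sup>2) pi) + 2 * P / norm k * e"
      using large(2) tri[of "cos (k * of_real pi)" "cs (\<lambda>t. p t - k\<^sup>2) pi"] Ap(1) by linarith
    moreover have "2 * P / norm k * e \<le> 1/8 * e" using small e0 by (intro mult_right_mono) auto
    ultimately show ?thesis by linarith
  qed
  have s: "e / (8 * norm k) \<le> norm (sn (\<lambda>t. p t - k\<^sup>2) pi)"
  proof -
    have "e / 4 / norm k \<le> norm (sin (k * of_real pi) / k)"
      using divide_right_mono[OF large(1), of "norm k"] by (simp add: norm_divide)
    then have "e / 4 / norm k \<le> norm (sn (\<lambda>t. p t - k\<^sup>2) pi) + 2 * P / (norm k)\<^sup>2 * e"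
      using tri[of "sin (k * of_real pi) / k" "sn (\<lambda>t. p t - k\<^sup>2) pi"] Ap(2) by linarith
    moreover have "2 * P / (norm k)\<^sup>2 * e \<le> 1/8 * (e / norm k)"
    proof -
      have "2 * P / (norm k)\<^sup>2 * e = 2 * P / norm k * (e / norm k)"
        by (simp add: power2_eq_square)
      also have "\<dots> \<le> 1/8 * (e / norm k)" using small e0 by (intro mult_right_mono) auto
      finally show ?thesis .
    qed
    moreover have "e / 4 / norm k = 2 * (e / (8 * norm k))" "1/8 * (e / norm k) = e / (8 * norm k)"
      by simp_all
    ultimately show ?thesis by linarith
  qed
  show "exp (\<bar>Im k\<bar> * pi) / 8 \<le> norm (cs (\<lambda>t. p t - k\<^sup>2) pi)"
    and "exp (\<bar>Im k\<bar> * pi) / (8 * norm k) \<le> norm (sn (\<lambda>t. p t - k\<^sup>2) pi)"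
    using c s by (simp_all add: e_def)
  have tri2: "norm (a - b) \<le> norm (a - c) + norm (b - c)" for a b c :: complex
    using norm_triangle_ineq4[of "a - c" "b - c"] by simp
  have "norm (cs (\<lambda>t. r t - k\<^sup>2) pi - cs (\<lambda>t. p t - k\<^sup>2) pi) \<le> 2 * P / norm k * e + 2 * P / norm k * e"
    by (rule order_trans[OF tri2 add_mono[OF Ar(1) Ap(1)]])
  also have "\<dots> = 32 * P / norm k * (e / 8)" by simp
  also have "\<dots> \<le> 32 * P / norm k * norm (cs (\<lambda>t. p t - k\<^sup>2) pi)"
    using P0 by (intro mult_left_mono c) auto
  finally show "norm (cs (\<lambda>t. r t - k\<^sup>2) pi - cs (\<lambda>t. p t - k\<^sup>2) pi) \<le> 32 * P / norm k * norm (cs (\<lambda>t. p t - k\<^sup>2) pi)" .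
  have "norm (sn (\<lambda>t. r t - k\<^sup>2) pi - sn (\<lambda>t. p t - k\<^sup>2) pi) \<le> 2 * P / (norm k)\<^sup>2 * e + 2 * P / (norm k)\<^sup>2 * e"
    by (rule order_trans[OF tri2 add_mono[OF Ar(2) Ap(2)]])
  also have "\<dots> = 32 * P / norm k * (e / (8 * norm k))" by (simp add: power2_eq_square)
  also have "\<dots> \<le> 32 * P / norm k * norm (sn (\<lambda>t. p t - k\<^sup>2) pi)"
    using P0 by (intro mult_left_mono s) auto
  finally show "norm (sn (\<lambda>t. r t - k\<^sup>2) pi - sn (\<lambda>t. p t - k\<^sup>2) pi) \<le> 32 * P / norm k * norm (sn (\<lambda>t. p t - k\<^sup>2) pi)" .
qed

text \<open>The shift \<open>1/4\<close> keeps the circles away from the zeros of both \<open>sin (pi * csqrt z)\<close> and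
  \<open>cos (pi * csqrt z)\<close>.\<close>

definition radius :: "nat \<Rightarrow> real" where "radius N = (real N + 1/4)\<^sup>2"

lemma filterlim_radius: "filterlim radius at_top sequentially"
proof (rule filterlim_at_top_mono[OF filterlim_real_sequentially])
  have "real N \<le> radius N" for N
  proof (cases N)
    case (Suc n)
    have "real N * 1 \<le> real N * real N" using Suc by (intro mult_left_mono) auto
    then show ?thesis by (simp add: radius_def power2_eq_square algebra_simps)
  qed (simp add: radius_def)
  then show "\<forall>\<^sub>F N in sequentially. real N \<le> radius N" by simp
qed

lemma tendsto_inverse_sqrt_radius: "(\<lambda>N. C / (real N + 1/4)) \<longlonglongrightarrow> 0"
proof (rule tendsto_divide_0[OF tendsto_const filterlim_at_top_imp_at_infinity])
  show "filterlim (\<lambda>N. real N + 1/4) at_top sequentially"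
    by (rule filterlim_at_top_mono[OF filterlim_real_sequentially]) simp
qed

text \<open>Asymptotics are available in terms of \<open>k\<close> with
  \<open>z = k\<^sup>2\<close>; on the circle \<open>csqrt z\<close> is a root of modulus
  \<open>N + 1/4\<close>.\<close>

lemma eventually_on_circles:
  fixes Q :: "nat \<Rightarrow> complex \<Rightarrow> bool"
  assumes "\<And>N k. norm k = real N + 1/4 \<Longrightarrow> N \<ge> 10 \<Longrightarrow> C \<le> norm k \<Longrightarrow> Q N (k\<^sup>2)"
  shows "\<forall>\<^sub>F N in sequentially. \<forall>z. norm z = radius N \<longrightarrow> Q N z"
proof -
  obtain N0 :: nat where N0: "C \<le> real N0" using real_arch_simple by blast
  show ?thesis
  proof (rule eventually_sequentiallyI[of "max 10 N0"], intro allI impI)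
    fix N and z :: complex assume N: "max 10 N0 \<le> N" and z: "norm z = radius N"
    have "norm (csqrt z) = real N + 1/4"
      by (simp add: norm_csqrt z radius_def)
    then show "Q N z"
      using assms[of "csqrt z" N] N N0 by simp
  qed
qed

section \<open>The Borg-Marchenko theorem\<close>

text \<open>Bennewitz' argument: on circles \<open>F\<close> is the difference of products of a solution small at 0
  with one small at \<open>pi\<close>, divided by \<open>sn pi\<close>, so the exponential growth cancels.\<close>

lemma cross_solutions_eq:
  fixes p r :: "real \<Rightarrow> complex"
  assumes p: "p absolutely_integrable_on {0..pi}" and r: "r absolutely_integrable_on {0..pi}"
    and sn: "\<And>z. sn (\<lambda>t. r t - z) pi = sn (\<lambda>t. p t - z) pi"
    and cs: "\<And>z. cs (\<lambda>t. r t - z) pi = cs (\<lambda>t. p t - z) pi"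
    and x: "x \<in> {0..pi}"
  shows "sn (\<lambda>t. p t - z) x * cs (\<lambda>t. r t - z) x = cs (\<lambda>t. p t - z) x * sn (\<lambda>t. r t - z) x"
proof -
  define F where "F z = sn (\<lambda>t. p t - z) x * cs (\<lambda>t. r t - z) x - cs (\<lambda>t. p t - z) x * sn (\<lambda>t. r t - z) x" for z
  define P where "P = max (integral {0..pi} (\<lambda>t. norm (p t))) (integral {0..pi} (\<lambda>t. norm (r t)))"
  have P: "integral {0..pi} (\<lambda>t. norm (p t)) \<le> P" "integral {0..pi} (\<lambda>t. norm (r t)) \<le> P"
    by (auto simp: P_def)
  have "(\<lambda>t. norm (p t)) integrable_on {0..pi}"
    using p by (simp add: absolutely_integrable_on_def)
  then have P0: "P \<ge> 0"
    using integral_nonneg[of "\<lambda>t. norm (p t)" "{0..pi}"] P(1) by simp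
  have "F z = 0"
  proof (rule entire_eq_0_if_small_on_circles[where f = F and \<xi> = z, OF _ filterlim_radius tendsto_inverse_sqrt_radius[of 64]])
    show "F holomorphic_on UNIV"
      unfolding F_def by (intro holomorphic_intros holomorphic_cauchy_solution p r x)
    show "\<forall>\<^sub>F N in sequentially. \<forall>z. norm z = radius N \<longrightarrow> norm (F z) \<le> 64 / (real N + 1/4)"
    proof (rule eventually_on_circles[of "16 * P"])
      fix N and k :: complex
      assume k: "norm k = real N + 1/4" "N \<ge> 10" "16 * P \<le> norm k"
      have k0: "k \<noteq> 0" "norm k > 0" using k by auto
      have k2: "2 * P \<le> norm k" using k P0 by simp
      let ?sp = "sn (\<lambda>t. p t - k\<^sup>2)" and ?cp = "cs (\<lambda>t. p t - k\<^sup>2)"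
      let ?sr = "sn (\<lambda>t. r t - k\<^sup>2)" and ?cr = "cs (\<lambda>t. r t - k\<^sup>2)"
      let ?e = "\<lambda>x. exp (\<bar>Im k\<bar> * x)"
      \<comment> \<open>The common values at \<open>pi\<close> make the two extra terms with
        \<open>?sp x * ?sr x\<close> cancel. In each product one factor grows like
        \<open>exp (\<bar>Im k\<bar> * x)\<close> and the other like
        \<open>exp (\<bar>Im k\<bar> * (pi - x))\<close>, which together match the lower bound for
        \<open>?sp pi\<close>.\<close>
      have "?sp pi * F (k\<^sup>2) = ?sp x * (?sr pi * ?cr x - ?cr pi * ?sr x) - (?sp pi * ?cp x - ?cp pi * ?sp x) * ?sr x"
        by (simp add: F_def sn cs algebra_simps)
      also have "norm \<dots> \<le> (2 / norm k * ?e x) * (2 / norm k * ?e (pi - x))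
          + (2 / norm k * ?e (pi - x)) * (2 / norm k * ?e x)"
        by (rule order_trans[OF norm_triangle_ineq4]; unfold norm_mult; intro add_mono mult_mono
          cs_sn_asymptotics(2)[OF p k0(1) P(1) k2 x] cs_sn_asymptotics(2)[OF r k0(1) P(2) k2 x]
          right_solution_bound[OF p k0(1) P(1) k2 x] right_solution_bound[OF r k0(1) P(2) k2 x]) auto
      also have "\<dots> = 8 / (norm k)\<^sup>2 * ?e pi"
        by (simp add: power2_eq_square exp_add[symmetric] algebra_simps)
      also have "\<dots> = 64 / norm k * (?e pi / (8 * norm k))"
        by (simp add: power2_eq_square)
      also have "\<dots> \<le> 64 / norm k * norm (?sp pi)"
        by (intro mult_left_mono circle_estimates(2)[OF p r P k]) auto
      finally have "norm (?sp pi) * norm (F (k\<^sup>2)) \<le> norm (?sp pi) * (64 / norm k)"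
        by (simp add: norm_mult mult.commute)
      moreover have "norm (?sp pi) > 0"
        by (rule less_le_trans[OF _ circle_estimates(2)[OF p r P k]]) (use k0 in simp)
      ultimately have "norm (F (k\<^sup>2)) \<le> 64 / norm k"
        by (rule mult_left_le_imp_le)
      then show "norm (F (k\<^sup>2)) \<le> 64 / (real N + 1/4)"
        by (simp only: k(1))
    qed
  qed
  then show ?thesis by (simp add: F_def)
qed

text \<open>The quotient \<open>sn / cs\<close> is common to both potentials, and its derivative is
  \<open>1 / cs\<^sup>2\<close> by the Wronskian, so the two \<open>cs\<close> agree up to sign. A
  single parameter far down the negative axis fixes the sign and keeps \<open>cs\<close> away from
  0; equality of the \<open>cs\<close> and of their derivatives then gives
  \<open>(r - p) * cs = 0\<close> almost everywhere.\<close>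

lemma potential_unique:
  fixes p r :: "real \<Rightarrow> complex"
  assumes p: "p absolutely_integrable_on {0..pi}" and r: "r absolutely_integrable_on {0..pi}"
    and sn: "\<And>z. sn (\<lambda>t. r t - z) pi = sn (\<lambda>t. p t - z) pi"
    and cs: "\<And>z. cs (\<lambda>t. r t - z) pi = cs (\<lambda>t. p t - z) pi"
  shows "AE x in lebesgue. x \<in> {0..pi} \<longrightarrow> r x = p x"
proof -
  define P where "P = max (integral {0..pi} (\<lambda>t. norm (p t))) (integral {0..pi} (\<lambda>t. norm (r t)))"
  have P: "integral {0..pi} (\<lambda>t. norm (p t)) \<le> P" "integral {0..pi} (\<lambda>t. norm (r t)) \<le> P"
    by (auto simp: P_def)
  have "(\<lambda>t. norm (p t)) integrable_on {0..pi}"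
    using p by (simp add: absolutely_integrable_on_def)
  then have P0: "P \<ge> 0"
    using integral_nonneg[of "\<lambda>t. norm (p t)" "{0..pi}"] P(1) by simp
  \<comment> \<open>Chosen so that \<open>2 * P / \<kappa> < 1/2\<close>: each \<open>cs\<close> is
    then closer to the hyperbolic cosine than \<open>exp (\<kappa> * x) / 2\<close>, a lower bound
    of the latter, so neither \<open>?cp x\<close> nor \<open>?cp x + ?cr x\<close> can
    vanish.\<close>
  define \<kappa> where "\<kappa> = 4 * P + 1"
  define k where "k = \<i> * of_real \<kappa>"
  have \<kappa>0: "\<kappa> > 0" using P0 by (simp add: \<kappa>_def)
  have k: "k \<noteq> 0" "norm k = \<kappa>" "Im k = \<kappa>" "2 * P \<le> norm k"
  proof -
    show "k \<noteq> 0" "norm k = \<kappa>" "Im k = \<kappa>"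
      using \<kappa>0 by (auto simp: k_def norm_mult)
    then show "2 * P \<le> norm k"
      using P0 by (simp add: \<kappa>_def)
  qed
  note pk = absolutely_integrable_minus_const[OF p, of "k\<^sup>2"]
    and rk = absolutely_integrable_minus_const[OF r, of "k\<^sup>2"]
  let ?sp = "sn (\<lambda>t. p t - k\<^sup>2)" and ?cp = "cs (\<lambda>t. p t - k\<^sup>2)"
  let ?sr = "sn (\<lambda>t. r t - k\<^sup>2)" and ?cr = "cs (\<lambda>t. r t - k\<^sup>2)"
  let ?sp' = "sn' (\<lambda>t. p t - k\<^sup>2)" and ?cp' = "cs' (\<lambda>t. p t - k\<^sup>2)"
  let ?sr' = "sn' (\<lambda>t. r t - k\<^sup>2)" and ?cr' = "cs' (\<lambda>t. r t - k\<^sup>2)"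
  have near: "norm (c - cos (k * of_real x)) < exp (\<kappa> * x) / 2"
    if "norm (c - cos (k * of_real x)) \<le> 2 * P / norm k * exp (\<bar>Im k\<bar> * x)" for c x
  proof -
    have "2 * P / norm k < 1 / 2"
      using \<kappa>0 by (simp add: k divide_less_eq) (simp add: \<kappa>_def)
    then have "2 * P / norm k * exp (\<kappa> * x) < 1 / 2 * exp (\<kappa> * x)"
      by (rule mult_strict_right_mono) simp
    with that show ?thesis using k(3) \<kappa>0 by simp
  qed
  have cosh: "norm (cos (k * of_real x)) \<ge> exp (\<kappa> * x) / 2" for x
  proof -
    have "cos (k * of_real x) = of_real ((exp (\<kappa> * x) + exp (- (\<kappa> * x))) / 2)"
      by (simp add: cos_exp_eq k_def exp_of_real[symmetric] algebra_simps)
    also have "norm \<dots> = (exp (\<kappa> * x) + exp (- (\<kappa> * x))) / 2"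
      by (simp only: norm_of_real) simp
    finally show ?thesis by simp
  qed
  have nearp: "norm (?cp x - cos (k * of_real x)) < exp (\<kappa> * x) / 2"
    and nearr: "norm (?cr x - cos (k * of_real x)) < exp (\<kappa> * x) / 2" if "x \<in> {0..pi}" for x
    using near cs_sn_asymptotics(3)[OF p k(1) P(1) k(4) that] cs_sn_asymptotics(3)[OF r k(1) P(2) k(4) that]
    by blast+
  have cp0: "?cp x \<noteq> 0" if "x \<in> {0..pi}" for x
    using nearp[OF that] cosh[of x] by (auto simp: norm_minus_commute)
  have sum0: "?cp x + ?cr x \<noteq> 0" if x: "x \<in> {0..pi}" for x
  proof
    assume "?cp x + ?cr x = 0"
    then have "2 * cos (k * of_real x) = - ((?cp x - cos (k * of_real x)) + (?cr x - cos (k * of_real x)))"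
      by (simp add: algebra_simps add_eq_0_iff)
    then have "2 * norm (cos (k * of_real x)) = norm ((?cp x - cos (k * of_real x)) + (?cr x - cos (k * of_real x)))"
      by (metis norm_minus_cancel norm_mult norm_numeral)
    also have "\<dots> < exp (\<kappa> * x) / 2 + exp (\<kappa> * x) / 2"
      by (intro le_less_trans[OF norm_triangle_ineq] add_strict_mono nearp nearr x)
    finally show False using cosh[of x] by simp
  qed
  have cross: "?sp x * ?cr x = ?cp x * ?sr x" if "x \<in> {0..pi}" for x
    by (rule cross_solutions_eq[OF p r sn cs that])
  have D: "(?sp has_vector_derivative ?sp' x) (at x within {0..pi})"
    "(?cp has_vector_derivative ?cp' x) (at x within {0..pi})"
    "(?sr has_vector_derivative ?sr' x) (at x within {0..pi})"
    "(?cr has_vector_derivative ?cr' x) (at x within {0..pi})" if "x \<in> {0..pi}" for x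
    by (intro ode_solutionD(1)[OF cauchy_solution(1)] pk rk that)+
  have unique: "d = d'"
    if "(f has_vector_derivative d) (at x within {0..pi})" "(f has_vector_derivative d') (at x within {0..pi})"
      "x \<in> {0..pi}" for f :: "real \<Rightarrow> complex" and d d' x
    using vector_derivative_unique_within_closed_interval[of 0 pi x f d d'] that by simp
  have c_eq: "?cr x = ?cp x" if x: "x \<in> {0..pi}" for x
  proof -
    have "((\<lambda>x. ?sp x * ?cr x) has_vector_derivative ?sp x * ?cr' x + ?sp' x * ?cr x) (at x within {0..pi})"
      by (intro has_vector_derivative_mult D x)
    moreover have "((\<lambda>x. ?cp x * ?sr x) has_vector_derivative ?cp x * ?sr' x + ?cp' x * ?sr x) (at x within {0..pi})"
      by (intro has_vector_derivative_mult D x)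
    then have "((\<lambda>x. ?sp x * ?cr x) has_vector_derivative ?cp x * ?sr' x + ?cp' x * ?sr x) (at x within {0..pi})"
      by (rule has_vector_derivative_transform[OF x, rotated]) (rule cross)
    ultimately have d: "?sp x * ?cr' x + ?sp' x * ?cr x = ?cp x * ?sr' x + ?cp' x * ?sr x"
      using unique x by blast
    \<comment> \<open>Comparing the derivatives of the two quotients \<open>sn / cs\<close> after
      clearing denominators: the right side vanishes by the cross relation and its derivative, and
      on the left both brackets are Wronskians equal to 1.\<close>
    have "?cr x * ?cr x * (?cp x * ?sp' x - ?cp' x * ?sp x) - ?cp x * ?cp x * (?cr x * ?sr' x - ?cr' x * ?sr x)
        = ?cp x * ?cr x * ((?sp x * ?cr' x + ?sp' x * ?cr x) - (?cp x * ?sr' x + ?cp' x * ?sr x))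
          + (?cp x * ?sr x - ?sp x * ?cr x) * (?cp' x * ?cr x + ?cp x * ?cr' x)"
      by (simp add: algebra_simps)
    also have "\<dots> = 0"
      using d cross[OF x] by simp
    finally have "(?cr x - ?cp x) * (?cp x + ?cr x) = 0"
      unfolding Wronskian_cs_sn[OF pk x] Wronskian_cs_sn[OF rk x] by (simp add: algebra_simps)
    then show ?thesis using sum0[OF x] by simp
  qed
  have c'_eq: "?cr' x = ?cp' x" if x: "x \<in> {0..pi}" for x
  proof -
    have "(?cr has_vector_derivative ?cp' x) (at x within {0..pi})"
      by (rule has_vector_derivative_transform[OF x _ D(2)[OF x]]) (rule c_eq)
    then show ?thesis using unique[OF D(4)[OF x]] x by blast
  qed
  note cp_int = ode_solution_continuous(3)[OF pk cauchy_solution(1)[OF pk, of 1 0]]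
    and cr_int = ode_solution_continuous(3)[OF rk cauchy_solution(1)[OF rk, of 1 0]]
  let ?g = "\<lambda>t. (r t - k\<^sup>2) * ?cr t - (p t - k\<^sup>2) * ?cp t"
  have "AE x in lebesgue. x \<in> {0..pi} \<longrightarrow> ?g x = 0"
  proof (rule AE_eq_0_if_indefinite_integral_eq_0)
    show "?g absolutely_integrable_on {0..pi}"
      by (rule set_integral_diff(1)[OF cr_int cp_int])
    fix x assume x: "x \<in> {0..pi}"
    have i: "(\<lambda>t. (r t - k\<^sup>2) * ?cr t) integrable_on {0..x}" "(\<lambda>t. (p t - k\<^sup>2) * ?cp t) integrable_on {0..x}"
      using absolutely_integrable_subinterval[OF cr_int, of 0 x] absolutely_integrable_subinterval[OF cp_int, of 0 x] x
      by (auto simp: absolutely_integrable_on_def)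
    have "integral {0..x} ?g = (?cr' x - ?cr' 0) - (?cp' x - ?cp' 0)"
      using ode_solutionD(2)[OF cauchy_solution(1)[OF pk, of 1 0] x]
        ode_solutionD(2)[OF cauchy_solution(1)[OF rk, of 1 0] x]
      unfolding integral_diff[OF i] by simp
    then show "integral {0..x} ?g = 0"
      using c'_eq[OF x] c'_eq[of 0] by simp
  qed
  then show ?thesis
  proof eventually_elim
    case (elim x)
    show ?case
    proof
      assume x: "x \<in> {0..pi}"
      then have "(r x - p x) * ?cp x = 0"
        using elim c_eq[OF x] by (simp add: algebra_simps)
      then show "r x = p x" using cp0[OF x] by simp
    qed
  qed
qed

section \<open>Spectral data\<close>

lemma integrable_potential:
  fixes q :: "real \<Rightarrow> real"
  assumes "q absolutely_integrable_on {0<..<pi}"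
  shows "(\<lambda>t. complex_of_real (q t)) absolutely_integrable_on {0..pi}"
proof -
  have "q absolutely_integrable_on {0..pi}"
    using assms absolutely_integrable_on_open_interval[of 0 pi q] by (simp add: box_real)
  from absolutely_integrable_linear[OF this bounded_linear_of_real]
  show ?thesis by (simp add: o_def)
qed

lemma schroedinger_solution_iff:
  assumes q: "(\<lambda>t. complex_of_real (q t)) absolutely_integrable_on {0..pi}"
  shows "schroedinger_solution q z u u' \<longleftrightarrow> ode_solution (\<lambda>t. of_real (q t) - z) u u'"
proof
  assume s: "schroedinger_solution q z u u'"
  then obtain u'' where u'': "u'' absolutely_integrable_on {0..pi}"
      "\<And>x. x \<in> {0..pi} \<Longrightarrow> u' x = u' 0 + (LINT t:{0..x}|lebesgue. u'' t)"
      "AE x in lebesgue. x \<in> {0<..<pi} \<longrightarrow> - u'' x + complex_of_real (q x) * u x = z * u x"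
    unfolding schroedinger_solution_def has_ac_derivative_def by blast
  show "ode_solution (\<lambda>t. of_real (q t) - z) u u'"
    unfolding ode_solution_def
  proof (intro conjI ballI)
    fix x assume x: "x \<in> {0..pi}"
    show "(u has_vector_derivative u' x) (at x within {0..pi})"
      using s x unfolding schroedinger_solution_def by blast
    have "(LINT t:{0..x}|lebesgue. u'' t) = integral {0..x} u''"
      using x by (intro set_lebesgue_integral_eq_integral(2) absolutely_integrable_subinterval[OF u''(1)]) auto
    also have "\<dots> = integral {0..x} (\<lambda>t. (of_real (q t) - z) * u t)"
    proof -
      obtain N where N: "negligible N"
          "{x. \<not> (x \<in> {0<..<pi} \<longrightarrow> - u'' x + complex_of_real (q x) * u x = z * u x)} \<subseteq> N"
        using u''(3) unfolding eventually_ae_filter_negligible by blast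
      show ?thesis
      proof (rule integral_spike)
        \<comment> \<open>The differential equation is posed on the open interval, hence the end
          points join the exceptional set.\<close>
        show "negligible (N \<union> {0, pi})"
          using N(1) by (simp add: negligible_Un)
        fix t assume "t \<in> {0..x} - (N \<union> {0, pi})"
        then have "t \<in> {0<..<pi}" "t \<notin> N" using x by auto
        then have "- u'' t + complex_of_real (q t) * u t = z * u t"
          using N(2) by blast
        then show "(of_real (q t) - z) * u t = u'' t"
          by (simp add: algebra_simps)
      qed
    qed
    finally show "u' x = u' 0 + integral {0..x} (\<lambda>t. (of_real (q t) - z) * u t)"
      using u''(2)[OF x] by simp
  qed
next
  assume u: "ode_solution (\<lambda>t. of_real (q t) - z) u u'"
  note pu = ode_solution_continuous(3)[OF absolutely_integrable_minus_const[OF q] u]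
  have "has_ac_derivative u' (\<lambda>t. (of_real (q t) - z) * u t)"
    unfolding has_ac_derivative_def
  proof (intro conjI ballI pu)
    fix x assume x: "x \<in> {0..pi}"
    have "(LINT t:{0..x}|lebesgue. (of_real (q t) - z) * u t) = integral {0..x} (\<lambda>t. (of_real (q t) - z) * u t)"
      using x by (intro set_lebesgue_integral_eq_integral(2) absolutely_integrable_subinterval[OF pu]) auto
    then show "u' x = u' 0 + (LINT t:{0..x}|lebesgue. (of_real (q t) - z) * u t)"
      using ode_solutionD(2)[OF u x] by simp
  qed
  then show "schroedinger_solution q z u u'"
    unfolding schroedinger_solution_def
    using ode_solutionD(1)[OF u] by (intro conjI exI[of _ "\<lambda>t. (of_real (q t) - z) * u t"]) (auto simp: algebra_simps)
qed

lemma sigma_DD_iff: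
  assumes q: "(\<lambda>t. complex_of_real (q t)) absolutely_integrable_on {0..pi}"
  shows "z \<in> sigma_DD q \<longleftrightarrow> sn (\<lambda>t. of_real (q t) - z) pi = 0"
proof -
  note pz = absolutely_integrable_minus_const[OF q, of z]
  show ?thesis
  proof
    assume "z \<in> sigma_DD q"
    then obtain u u' x where u: "ode_solution (\<lambda>t. of_real (q t) - z) u u'" and x: "x \<in> {0..pi}" "u x \<noteq> 0"
        and 0: "u 0 = 0" "u pi = 0"
      unfolding sigma_DD_def schroedinger_solution_iff[OF q] by blast
    show "sn (\<lambda>t. of_real (q t) - z) pi = 0"
      using ode_solution_unique(1)[OF pz u x(1)] ode_solution_unique(1)[OF pz u, of pi] x(2) 0 by auto
  next
    assume 0: "sn (\<lambda>t. of_real (q t) - z) pi = 0"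
    have "\<exists>x\<in>{0..pi}. sn (\<lambda>t. of_real (q t) - z) x \<noteq> 0"
    proof (rule ccontr)
      assume "\<not> ?thesis"
      then have "(sn (\<lambda>t. of_real (q t) - z) has_vector_derivative 0) (at 0 within {0..pi})"
        by (intro has_vector_derivative_transform[OF _ _ has_vector_derivative_const[of 0]]) auto
      moreover have "(sn (\<lambda>t. of_real (q t) - z) has_vector_derivative 1) (at 0 within {0..pi})"
        using ode_solutionD(1)[OF cauchy_solution(1)[OF pz, of 0 1], of 0] cauchy_solution(3)[OF pz, of 0 1] by simp
      ultimately show False
        using vector_derivative_unique_within_closed_interval[of 0 pi 0 "sn (\<lambda>t. of_real (q t) - z)" 0 1] by simp
    qed
    then show "z \<in> sigma_DD q"
      unfolding sigma_DD_def schroedinger_solution_iff[OF q]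
      using cauchy_solution[OF pz, of 0 1] 0 by blast
  qed
qed

lemma sigma_ND_iff:
  assumes q: "(\<lambda>t. complex_of_real (q t)) absolutely_integrable_on {0..pi}"
  shows "z \<in> sigma_ND q \<longleftrightarrow> cs (\<lambda>t. of_real (q t) - z) pi = 0"
proof -
  note pz = absolutely_integrable_minus_const[OF q, of z]
  show ?thesis
  proof
    assume "z \<in> sigma_ND q"
    then obtain u u' x where u: "ode_solution (\<lambda>t. of_real (q t) - z) u u'" and x: "x \<in> {0..pi}" "u x \<noteq> 0"
        and 0: "u' 0 = 0" "u pi = 0"
      unfolding sigma_ND_def schroedinger_solution_iff[OF q] by blast
    show "cs (\<lambda>t. of_real (q t) - z) pi = 0"
      using ode_solution_unique(1)[OF pz u x(1)] ode_solution_unique(1)[OF pz u, of pi] x(2) 0 by auto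
  next
    assume 0: "cs (\<lambda>t. of_real (q t) - z) pi = 0"
    have "\<exists>x\<in>{0..pi}. cs (\<lambda>t. of_real (q t) - z) x \<noteq> 0"
      using cauchy_solution(2)[OF pz, of 1 0] by (intro bexI[of _ 0]) auto
    then show "z \<in> sigma_ND q"
      unfolding sigma_ND_def schroedinger_solution_iff[OF q]
      using cauchy_solution[OF pz, of 1 0] 0 by blast
  qed
qed

text \<open>\<open>sine_solution\<close> and \<open>sn\<close> are independent arbitrary choices,
  but uniqueness makes them agree on \<open>{0..pi}\<close>, where the integral lives.\<close>

lemma spectral_mass_eq:
  assumes q: "(\<lambda>t. complex_of_real (q t)) absolutely_integrable_on {0..pi}"
  shows "spectral_mass q z = inverse (integral {0..pi} (\<lambda>t. (norm (sn (\<lambda>t. of_real (q t) - z) t))\<^sup>2))"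
proof -
  note pz = absolutely_integrable_minus_const[OF q, of z]
  have "\<exists>s s'. schroedinger_solution q z s s' \<and> s 0 = 0 \<and> s' 0 = 1"
    unfolding schroedinger_solution_iff[OF q] using cauchy_solution[OF pz, of 0 1] by blast
  then have "\<exists>s'. schroedinger_solution q z (sine_solution q z) s' \<and> sine_solution q z 0 = 0 \<and> s' 0 = 1"
    unfolding sine_solution_def by (rule someI_ex)
  then obtain s' where s': "ode_solution (\<lambda>t. of_real (q t) - z) (sine_solution q z) s'"
      "sine_solution q z 0 = 0" "s' 0 = 1"
    unfolding schroedinger_solution_iff[OF q] by blast
  have eq: "sine_solution q z t = sn (\<lambda>t. of_real (q t) - z) t" if "t \<in> {0..pi}" for t
    using ode_solution_unique(1)[OF pz s'(1) that] s' by simp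
  have "continuous_on {0..pi} (sn (\<lambda>t. of_real (q t) - z))"
    by (rule ode_solution_continuous(1)[OF pz cauchy_solution(1)[OF pz]])
  then have ai: "(\<lambda>t. (norm (sn (\<lambda>t. of_real (q t) - z) t))\<^sup>2) absolutely_integrable_on {0..pi}"
    by (intro absolutely_integrable_continuous_real continuous_intros)
  have "(LINT t:{0..pi}|lebesgue. (norm (sine_solution q z t))\<^sup>2)
      = (LINT t:{0..pi}|lebesgue. (norm (sn (\<lambda>t. of_real (q t) - z) t))\<^sup>2)"
    by (intro set_lebesgue_integral_cong) (auto simp: eq)
  also have "\<dots> = integral {0..pi} (\<lambda>t. (norm (sn (\<lambda>t. of_real (q t) - z) t))\<^sup>2)"
    by (rule set_lebesgue_integral_eq_integral(2)[OF ai])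
  finally show ?thesis
    by (simp add: spectral_mass_def)
qed

section \<open>Norming constants and simplicity of the eigenvalues\<close>

lemma integral_square_real:
  fixes f :: "real \<Rightarrow> complex"
  assumes f: "continuous_on {a..b} f" "\<And>t. t \<in> {a..b} \<Longrightarrow> cnj (f t) = f t"
  shows "integral {a..b} (\<lambda>t. f t * f t) = of_real (integral {a..b} (\<lambda>t. (norm (f t))\<^sup>2))"
proof (rule integral_unique)
  have "(\<lambda>t. (norm (f t))\<^sup>2) integrable_on {a..b}"
    by (intro integrable_continuous_real continuous_intros f)
  then have "((\<lambda>t. complex_of_real ((norm (f t))\<^sup>2)) has_integral
      of_real (integral {a..b} (\<lambda>t. (norm (f t))\<^sup>2))) {a..b}"
    by (intro has_integral_of_real integrable_integral)
  then show "((\<lambda>t. f t * f t) has_integral of_real (integral {a..b} (\<lambda>t. (norm (f t))\<^sup>2))) {a..b}"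
  proof (rule has_integral_eq[rotated])
    fix t assume "t \<in> {a..b}"
    then show "complex_of_real ((norm (f t))\<^sup>2) = f t * f t"
      using complex_norm_square[of "f t"] f(2)[of t] by simp
  qed
qed

lemma integral_norm_square_pos:
  assumes p: "p absolutely_integrable_on {0..pi}" and u: "ode_solution p u v" and nz: "u 0 \<noteq> 0 \<or> v 0 \<noteq> 0"
  shows "integral {0..pi} (\<lambda>t. (norm (u t))\<^sup>2) > 0"
proof -
  have c: "continuous_on {0..pi} (\<lambda>t. (norm (u t))\<^sup>2)"
    by (intro continuous_intros ode_solution_continuous(1)[OF p u])
  have "integral {0..pi} (\<lambda>t. (norm (u t))\<^sup>2) \<noteq> 0"
  proof
    assume "integral {0..pi} (\<lambda>t. (norm (u t))\<^sup>2) = 0"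
    then have u0: "u x = 0" if "x \<in> {0..pi}" for x
      using integral_eq_0_iff[OF c] that by simp
    have "(u has_vector_derivative 0) (at 0 within {0..pi})"
      by (rule has_vector_derivative_transform[OF _ _ has_vector_derivative_const[of 0]]) (use u0 in auto)
    moreover have "(u has_vector_derivative v 0) (at 0 within {0..pi})"
      using ode_solutionD(1)[OF u, of 0] by simp
    ultimately have "v 0 = 0"
      using vector_derivative_unique_within_closed_interval[of 0 pi 0 u 0 "v 0"] by simp
    then show False using nz u0[of 0] by simp
  qed
  moreover have "integral {0..pi} (\<lambda>t. (norm (u t))\<^sup>2) \<ge> 0"
    by (intro integral_nonneg integrable_continuous_real c) auto
  ultimately show ?thesis by simp
qed

text \<open>At an eigenvalue one of the two terms in the derivative with respect to the spectral
  parameter drops out, and the other contains the square of the real eigenfunction. Positivity of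
  its integral, with the Wronskian, makes the zeros simple; for \<open>S\<close> the integral is the
  reciprocal of the spectral mass.\<close>

lemma deriv_at_eigenvalue:
  fixes q :: "real \<Rightarrow> real" and w :: real
  assumes q: "(\<lambda>t. complex_of_real (q t)) absolutely_integrable_on {0..pi}"
  defines "S \<equiv> \<lambda>z. sn (\<lambda>t. of_real (q t) - z)" and "C \<equiv> \<lambda>z. cs (\<lambda>t. of_real (q t) - z)"
  shows "S w pi = 0 \<Longrightarrow> deriv (\<lambda>z. S z pi) w = C w pi * of_real (integral {0..pi} (\<lambda>t. (norm (S w t))\<^sup>2))"
    and "C w pi = 0 \<Longrightarrow> deriv (\<lambda>z. C z pi) w = - (S w pi * of_real (integral {0..pi} (\<lambda>t. (norm (C w t))\<^sup>2)))"
    and "integral {0..pi} (\<lambda>t. (norm (S w t))\<^sup>2) > 0" "integral {0..pi} (\<lambda>t. (norm (C w t))\<^sup>2) > 0"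
    and "S w pi = 0 \<Longrightarrow> C w pi \<noteq> 0"
proof -
  note pw = absolutely_integrable_minus_const[OF q, of "of_real w"]
  have cnj: "cnj (S w t) = S w t" "cnj (C w t) = C w t" if "t \<in> {0..pi}" for t
    unfolding S_def C_def by (intro cnj_sn_cs[OF pw _ that]; simp)+
  have cont: "continuous_on {0..pi} (S w)" "continuous_on {0..pi} (C w)"
    unfolding S_def C_def by (intro ode_solution_continuous(1)[OF pw cauchy_solution(1)[OF pw]])+
  note D = DERIV_imp_deriv[OF has_field_derivative_cauchy_solution[OF q, of pi _ _ "of_real w"], simplified]
  show "deriv (\<lambda>z. S z pi) w = C w pi * of_real (integral {0..pi} (\<lambda>t. (norm (S w t))\<^sup>2))"
    if "S w pi = 0"
    using D[of 0 1] that integral_square_real[OF cont(1) cnj(1)] by (simp add: S_def C_def)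
  show "deriv (\<lambda>z. C z pi) w = - (S w pi * of_real (integral {0..pi} (\<lambda>t. (norm (C w t))\<^sup>2)))"
    if "C w pi = 0"
    using D[of 1 0] that integral_square_real[OF cont(2) cnj(2)] by (simp add: S_def C_def)
  show "integral {0..pi} (\<lambda>t. (norm (S w t))\<^sup>2) > 0" "integral {0..pi} (\<lambda>t. (norm (C w t))\<^sup>2) > 0"
    unfolding S_def C_def
    by (rule integral_norm_square_pos[OF pw cauchy_solution(1)[OF pw]], simp add: cauchy_solution(2,3)[OF pw])+
  show "C w pi \<noteq> 0" if "S w pi = 0"
    using Wronskian_cs_sn[OF pw, of pi] that by (auto simp: S_def C_def)
qed

text \<open>Indices outside \<open>range l\<close> contribute 0, and the others reindex to a finite
  part of the given convergent series. This is the uniform bound that the comparison of zeros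
  requires.\<close>

lemma sum_shifted_zeros_le:
  fixes a b :: "nat \<Rightarrow> real" and k l :: "nat \<Rightarrow> nat"
  assumes l: "inj l" and conv: "summable (\<lambda>n. \<bar>a (k n) / b (l n) - 1\<bar>)" and F: "finite F"
    and b: "\<And>n. b n \<noteq> 0"
  shows "(\<Sum>j\<in>F. \<bar>(if j \<in> range l then a (k (inv l j)) else b j) / b j - 1\<bar>)
    \<le> (\<Sum>n. \<bar>a (k n) / b (l n) - 1\<bar>)"
proof -
  let ?t = "\<lambda>j. \<bar>(if j \<in> range l then a (k (inv l j)) else b j) / b j - 1\<bar>"
  have "sum ?t F = sum ?t (F \<inter> range l)"
    using F b by (intro sum.mono_neutral_right) auto
  also have "F \<inter> range l = l ` (l -` F)" by auto
  also have "sum ?t (l ` (l -` F)) = (\<Sum>n\<in>l -` F. \<bar>a (k n) / b (l n) - 1\<bar>)"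
    using l by (subst sum.reindex) (auto intro: inj_on_subset)
  also have "\<dots> \<le> (\<Sum>n. \<bar>a (k n) / b (l n) - 1\<bar>)"
    using l F by (intro sum_le_suminf conv finite_vimageI) auto
  finally show ?thesis .
qed

theorem theorem4p8:
  fixes q q' :: "real \<Rightarrow> real"
    and a b \<gamma> a' b' \<gamma>' :: "nat \<Rightarrow> real"
    and k l :: "nat \<Rightarrow> nat"
  assumes q: "q absolutely_integrable_on {0<..<pi}"
    and a: "strict_mono a" "sigma_DD q = range (\<lambda>n. complex_of_real (a n))"
    and b: "strict_mono b" "sigma_ND q = range (\<lambda>n. complex_of_real (b n))"
    and a_pos: "\<And>n. 0 < a n"
    and b_pos: "\<And>n. 0 < b n"
    and \<gamma>: "\<And>n. \<gamma> n = spectral_mass q (complex_of_real (a n))"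
    and k: "strict_mono k"
    and l: "strict_mono l"
    and conv: "summable (\<lambda>n. \<bar>a (k n) / b (l n) - 1\<bar>)"
    and q': "q' absolutely_integrable_on {0<..<pi}"
    and a': "strict_mono a'" "sigma_DD q' = range (\<lambda>n. complex_of_real (a' n))"
    and b': "strict_mono b'" "sigma_ND q' = range (\<lambda>n. complex_of_real (b' n))"
    and \<gamma>': "\<And>n. \<gamma>' n = spectral_mass q' (complex_of_real (a' n))"
    and eq_a: "\<And>n. a' n = a n"
    and eq_b: "\<And>j. j \<notin> range l \<Longrightarrow> b' j = b j"
    and eq_\<gamma>: "\<And>n. \<gamma>' (k n) = \<gamma> (k n)"
  shows "AE x in lebesgue. x \<in> {0<..<pi} \<longrightarrow> q' x = q x"
proof -
  let ?p = "\<lambda>t. complex_of_real (q t)" and ?r = "\<lambda>t. complex_of_real (q' t)"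
  note p = integrable_potential[OF q] and r = integrable_potential[OF q']
  let ?Sp = "\<lambda>z. sn (\<lambda>t. ?p t - z)" and ?Cp = "\<lambda>z. cs (\<lambda>t. ?p t - z)"
  let ?Sr = "\<lambda>z. sn (\<lambda>t. ?r t - z)" and ?Cr = "\<lambda>z. cs (\<lambda>t. ?r t - z)"
  define P where "P = max (integral {0..pi} (\<lambda>t. norm (?p t))) (integral {0..pi} (\<lambda>t. norm (?r t)))"
  have P: "integral {0..pi} (\<lambda>t. norm (?p t)) \<le> P" "integral {0..pi} (\<lambda>t. norm (?r t)) \<le> P"
    by (auto simp: P_def)
  have hol: "(\<lambda>z. ?Sp z pi) holomorphic_on UNIV" "(\<lambda>z. ?Cp z pi) holomorphic_on UNIV"
    "(\<lambda>z. ?Sr z pi) holomorphic_on UNIV" "(\<lambda>z. ?Cr z pi) holomorphic_on UNIV"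
    by (intro holomorphic_cauchy_solution p r; simp)+
  have zS: "?Sp z pi = 0 \<longleftrightarrow> (\<exists>n. z = of_real (a n))" for z
    unfolding sigma_DD_iff[OF p, symmetric] a(2) by blast
  have zC: "?Cp z pi = 0 \<longleftrightarrow> (\<exists>n. z = of_real (b n))" for z
    unfolding sigma_ND_iff[OF p, symmetric] b(2) by blast
  have zSr: "?Sr (of_real (a n)) pi = 0" for n
    unfolding sigma_DD_iff[OF r, symmetric] a'(2) eq_a by blast
  have zCr: "?Cr (of_real (b j)) pi = 0" if "j \<notin> range l" for j
    unfolding sigma_ND_iff[OF r, symmetric] b'(2) eq_b[OF that, symmetric] by blast
  have zSp: "?Sp (of_real (a n)) pi = 0" for n using zS by blast
  have zCp: "?Cp (of_real (b n)) pi = 0" for n using zC by blast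
  have Sp_nz: "?Sp (of_real (b n)) pi \<noteq> 0" for n
    using deriv_at_eigenvalue(5)[OF p] zCp by blast
  \<comment> \<open>Disjointness of the two spectra will keep the perturbed zeros pairwise
    distinct.\<close>
  have a_b: "a i \<noteq> b j" for i j
    using zSp[of i] Sp_nz[of j] by auto
  have S_eq: "?Sr z pi = ?Sp z pi" for z
  proof -
    \<comment> \<open>Comparison in the case where no zero moves: the difference vanishes at every
      \<open>a n\<close>, so the sum of the relative shifts is 0.\<close>
    have "?Sr z pi - ?Sp z pi = 0"
    proof (rule entire_eq_0_if_comparable_zeros[where f = "\<lambda>z. ?Sp z pi" and D = "\<lambda>z. ?Sr z pi - ?Sp z pi"
          and b = a and w = a and M = 0 and R = radius and \<xi> = z, OF hol(1) zS])
      show "deriv (\<lambda>z. ?Sp z pi) (of_real (a n)) \<noteq> 0" for n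
        unfolding deriv_at_eigenvalue(1)[OF p zSp]
        using deriv_at_eigenvalue(3)[OF p, of "a n"] deriv_at_eigenvalue(5)[OF p zSp, of n] by simp
      show "(\<lambda>z. ?Sr z pi - ?Sp z pi) holomorphic_on UNIV"
        by (intro holomorphic_on_diff hol)
      show "(\<Sum>n\<in>F. \<bar>a n / a n - 1\<bar>) \<le> 0" for F
        using less_imp_neq[OF a_pos] by simp
      show "\<forall>\<^sub>F N in sequentially. \<forall>z. norm z = radius N \<longrightarrow>
          ?Sp z pi \<noteq> 0 \<and> norm (?Sr z pi - ?Sp z pi) \<le> 32 * P / (real N + 1/4) * norm (?Sp z pi)"
      proof (rule eventually_on_circles, intro conjI)
        fix N and k :: complex
        assume k: "norm k = real N + 1/4" "N \<ge> 10" "16 * P \<le> norm k"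
        show "?Sp (k\<^sup>2) pi \<noteq> 0"
          using less_le_trans[OF _ circle_estimates(2)[OF p r P k]] k by force
        show "norm (?Sr (k\<^sup>2) pi - ?Sp (k\<^sup>2) pi) \<le> 32 * P / (real N + 1/4) * norm (?Sp (k\<^sup>2) pi)"
          using circle_estimates(4)[OF p r P k] unfolding k(1) .
      qed
    qed (use a_pos strict_mono_imp_inj_on[OF a(1)] zSp zSr in
        \<open>simp_all add: filterlim_radius tendsto_inverse_sqrt_radius\<close>)
    then show ?thesis by simp
  qed
  have C_eq_a: "?Cr (of_real (a (k n))) pi = ?Cp (of_real (a (k n))) pi" for n
  proof -
    let ?x = "a (k n)"
    \<comment> \<open>Equality as functions gives equal derivatives at the eigenvalue, that is,
      equal products of \<open>cs pi\<close> with the squared norm; the common mass then cancels the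
      norms, which are positive.\<close>
    have "(\<lambda>z. ?Sr z pi) = (\<lambda>z. ?Sp z pi)" using S_eq by blast
    then have "?Cr (of_real ?x) pi * of_real (integral {0..pi} (\<lambda>t. (norm (?Sr (of_real ?x) t))\<^sup>2))
        = ?Cp (of_real ?x) pi * of_real (integral {0..pi} (\<lambda>t. (norm (?Sp (of_real ?x) t))\<^sup>2))"
      unfolding deriv_at_eigenvalue(1)[OF p zSp, symmetric] deriv_at_eigenvalue(1)[OF r zSr, symmetric]
      by (simp only:)
    moreover have "integral {0..pi} (\<lambda>t. (norm (?Sr (of_real ?x) t))\<^sup>2)
        = integral {0..pi} (\<lambda>t. (norm (?Sp (of_real ?x) t))\<^sup>2)"
      using eq_\<gamma>[of n] unfolding \<gamma> \<gamma>' eq_a spectral_mass_eq[OF p] spectral_mass_eq[OF r]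
      by simp
    ultimately show ?thesis
      using deriv_at_eigenvalue(3)[OF p, of ?x] by simp
  qed
  have C_eq: "?Cr z pi = ?Cp z pi" for z
  proof -
    \<comment> \<open>The zero \<open>b (l n)\<close> is moved to \<open>a (k n)\<close>, where the
      two \<open>cs pi\<close> agree thanks to the masses. Every other \<open>b j\<close> stays in
      place, being a common zero of both functions.\<close>
    define w where "w j = (if j \<in> range l then a (k (inv l j)) else b j)" for j
    have inj_l: "inj l" and inj_k: "inj k" and inj_a: "inj a" and inj_b: "inj b"
      using k l a(1) b(1) by (simp_all add: strict_mono_imp_inj_on)
    have "inj w"
    proof (rule injI)
      fix i j assume ij: "w i = w j"
      show "i = j"
      proof (cases "i \<in> range l \<longleftrightarrow> j \<in> range l")
        case True
        show ?thesis
        proof (cases "i \<in> range l")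
          case i: True
          then have "inv l i = inv l j"
            using ij True inj_k inj_a by (simp add: w_def inj_eq)
          then show ?thesis
            using i True by (metis f_inv_into_f)
        next
          case False
          then show ?thesis using ij True inj_b by (simp add: w_def inj_eq)
        qed
      next
        case False
        then show ?thesis using ij a_b a_b[symmetric] by (auto simp: w_def split: if_splits)
      qed
    qed
    have "?Cr z pi - ?Cp z pi = 0"
    proof (rule entire_eq_0_if_comparable_zeros[where f = "\<lambda>z. ?Cp z pi" and D = "\<lambda>z. ?Cr z pi - ?Cp z pi"
          and b = b and w = w and R = radius and \<xi> = z, OF hol(2) zC])
      show "deriv (\<lambda>z. ?Cp z pi) (of_real (b n)) \<noteq> 0" for n
        unfolding deriv_at_eigenvalue(2)[OF p zCp]
        using deriv_at_eigenvalue(4)[OF p, of "b n"] Sp_nz[of n] by simp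
      show "(\<lambda>z. ?Cr z pi - ?Cp z pi) holomorphic_on UNIV"
        by (intro holomorphic_on_diff hol)
      show "inj w" by fact
      show "?Cr (of_real (w n)) pi - ?Cp (of_real (w n)) pi = 0" for n
        using C_eq_a zCp zCr by (simp add: w_def)
      show "(\<Sum>n\<in>F. \<bar>w n / b n - 1\<bar>) \<le> (\<Sum>n. \<bar>a (k n) / b (l n) - 1\<bar>)" if "finite F" for F
        unfolding w_def using less_imp_neq[OF b_pos]
        by (intro sum_shifted_zeros_le inj_l conv that) metis
      show "\<forall>\<^sub>F N in sequentially. \<forall>z. norm z = radius N \<longrightarrow>
          ?Cp z pi \<noteq> 0 \<and> norm (?Cr z pi - ?Cp z pi) \<le> 32 * P / (real N + 1/4) * norm (?Cp z pi)"
      proof (rule eventually_on_circles, intro conjI)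
        fix N and k :: complex
        assume k: "norm k = real N + 1/4" "N \<ge> 10" "16 * P \<le> norm k"
        show "?Cp (k\<^sup>2) pi \<noteq> 0"
          using less_le_trans[OF _ circle_estimates(1)[OF p r P k]] by force
        show "norm (?Cr (k\<^sup>2) pi - ?Cp (k\<^sup>2) pi) \<le> 32 * P / (real N + 1/4) * norm (?Cp (k\<^sup>2) pi)"
          using circle_estimates(3)[OF p r P k] unfolding k(1) .
      qed
    qed (use a_pos b_pos inj_b in \<open>simp_all add: w_def filterlim_radius tendsto_inverse_sqrt_radius\<close>)
    then show ?thesis by simp
  qed
  have "AE x in lebesgue. x \<in> {0..pi} \<longrightarrow> ?r x = ?p x"
    by (rule potential_unique[OF p r S_eq C_eq])
  then show ?thesis
    by eventually_elim auto
qed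

end
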